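(* Let $p\in(0,1)$, and let $(\mathcal{G}_x)_{x\in\mathbb{Z}^2}$ be i.i.d. with $\mathcal{G}_x=\{e_1,-e_1,-e_2\}$ with probability $p$ and $\mathcal{G}_x=\{-e_1,-e_2\}$ with probability $1-p$. Put $\gamma=\frac{3+\sqrt5}{2}$ and $\tilde\Theta(z)=\sum_{n=0}^\infty\frac{z^n}{\gamma^{2n+1}(1-2\gamma)-\gamma+2}$ for $|z|<\gamma^2$. Let $T$ be the first time that the random walk $(X_n)$ in the associated uniform random environment, started at the origin, takes a step in direction $-e_2$. Then $$E[T]=S_0+\frac{S_1\,A_0}{1-(1-p)(1-\gamma^2)\tilde\Theta(p\gamma)},$$ where $$S_0=3+\frac{(1-p)^2}{\gamma-1}\Big[(\gamma^3+6\gamma^2-3\gamma)\tilde\Theta(p\gamma^2)+(3\gamma^3-7\gamma^2-7\gamma+3)\tilde\Theta(p\gamma)-(3\gamma^2-6\gamma-1)\tilde\Theta(p)\Big],$$ $$S_1=3+(1-p)\Big[\gamma^2\tilde\Theta(p\gamma^2)+3(\gamma^2-1)\tilde\Theta(p\gamma)-\tilde\Theta(p)\Big],$$ $$A_0=\frac{(1-p)^2}{\gamma-1}\Big[\gamma(1-2\gamma)\tilde\Theta(p\gamma^2)-(\gamma^3-2\gamma^2-2\gamma+1)\tilde\Theta(p\gamma)+\gamma(\gamma-2)\tilde\Theta(p)\Big].$$ Moreover $P(n^{-1}X_n\to v)=1$ with $v=(v^{[1]},v^{[2]})$ given by $v^{[2]}=-1/E[T]$ and $v^{[1]}=1+3v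^{[2]}$.
   Context: $e_1=(1,0)$ and $e_2=(0,1)$ are the unit vectors of $\mathbb{Z}^2$. Given a realization of the i.i.d. non-empty sets $(\mathcal{G}_x)_{x\in\mathbb{Z}^2}$, each a subset of $\{\pm e_1,\pm e_2\}$, the walk in the associated uniform random environment is the time-homogeneous Markov chain $(X_n)_{n\ge0}$ on $\mathbb{Z}^2$ with $X_0=0$ that moves from $x$ to $x+e$ with probability $1/|\mathcal{G}_x|$ if $e\in\mathcal{G}_x$, and with probability $0$ otherwise. The environment is sampled once and kept fixed. $P$ denotes the annealed law, i.e. the law of the walk averaged over the environment, and $E$ its expectation. The time $T$ is the smallest $n\ge1$ with $X_n-X_{n-1}=-e_2$. *)

theory Defs
  imports "HOL-Probability.Probability"
begin

type_synonym site = "int \<times> int"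

abbreviation e1 :: site where "e1 \<equiv> (1, 0)"
abbreviation e2 :: site where "e2 \<equiv> (0, 1)"

definition to_plane :: "site \<Rightarrow> real \<times> real" where
  "to_plane z = (real_of_int (fst z), real_of_int (snd z))"

text \<open>An environment assigns to each site the set of its allowed steps. The uniform distribution
  on that set is only meaningful if the set is finite and non-empty.\<close>

abbreviation env_space :: "(site \<Rightarrow> site set) measure" where
  "env_space \<equiv> Pi\<^sub>M UNIV (\<lambda>_. count_space UNIV)"

abbreviation path_space :: "(nat \<Rightarrow> site) measure" where
  "path_space \<equiv> Pi\<^sub>M UNIV (\<lambda>_. count_space UNIV)"

definition jump :: "(site \<Rightarrow> site set) \<Rightarrow> site \<Rightarrow> site pmf" where
  "jump \<omega> x = map_pmf (\<lambda>e. x + e) (pmf_of_set (\<omega> x))"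

text \<open>The conditional law of the position at time \<open>n\<close>, given the positions
  \<open>h 0, \<dots>, h (n - 1)\<close>.\<close>

definition walk_kernel :: "(site \<Rightarrow> site set) \<Rightarrow> nat \<Rightarrow> (nat \<Rightarrow> site) \<Rightarrow> site measure" where
  "walk_kernel \<omega> n h =
     (case n of 0 \<Rightarrow> measure_pmf (return_pmf 0) | Suc m \<Rightarrow> measure_pmf (jump \<omega> (h m)))"

text \<open>The law on path space of the Markov chain in the fixed environment \<open>\<omega>\<close>, as the
  Ionescu-Tulcea limit of these kernels; \<open>emeasure_quenched_path\<close> below gives its
  finite-dimensional distributions, which determine it.\<close>

definition quenched :: "(site \<Rightarrow> site set) \<Rightarrow> (nat \<Rightarrow> site) measure" where
  "quenched \<omega> =
     projective_family.lim UNIV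
       (Ionescu_Tulcea.CI (walk_kernel \<omega>) (\<lambda>_. count_space UNIV)) (\<lambda>_. count_space UNIV)"

text \<open>The annealed law, where the environment is a random element on the probability space
  \<open>M\<close>. The bind is a genuine average of the quenched laws because of
  \<open>measurable_quenched\<close>.\<close>

definition annealed :: "'a measure \<Rightarrow> (site \<Rightarrow> 'a \<Rightarrow> site set) \<Rightarrow> (nat \<Rightarrow> site) measure" where
  "annealed M G = M \<bind> (\<lambda>w. quenched (\<lambda>x. G x w))"

text \<open>The infimum of the empty set is \<open>\<infinity>\<close>.\<close>

definition first_down :: "(nat \<Rightarrow> site) \<Rightarrow> enat" where
  "first_down X = Inf (enat ` {n. n \<ge> 1 \<and> X n - X (n - 1) = - e2})"

definition gam :: real where
  "gam = (3 + sqrt 5) / 2"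

definition Theta :: "real \<Rightarrow> real" where
  "Theta z = (\<Sum>n. z ^ n / (gam ^ (2 * n + 1) * (1 - 2 * gam) - gam + 2))"


lemma space_path_space [simp]: "space path_space = UNIV"
  by (simp add: space_PiM)

lemma pmf_jump: "pmf (jump \<omega> x) y = pmf (pmf_of_set (\<omega> x)) (y - x)"
proof -
  have "pmf (map_pmf (\<lambda>e. x + e) (pmf_of_set (\<omega> x))) (x + (y - x)) = pmf (pmf_of_set (\<omega> x)) (y - x)"
    by (rule pmf_map_inj') (simp add: inj_def)
  then show ?thesis
    by (simp add: jump_def)
qed

lemma walk_Ionescu_Tulcea: "Ionescu_Tulcea (walk_kernel \<omega>) (\<lambda>_. count_space UNIV)"
proof (rule Ionescu_Tulcea.intro)
  fix i
  show "walk_kernel \<omega> i \<in> measurable (Pi\<^sub>M {0..<i} (\<lambda>_. count_space UNIV)) (subprob_algebra (count_space UNIV))"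
  proof (cases i)
    case 0
    then show ?thesis
      unfolding walk_kernel_def[abs_def]
      by (auto simp: space_subprob_algebra intro: prob_space_imp_subprob_space measure_pmf.prob_space_axioms)
  next
    case (Suc m)
    have 1: "(\<lambda>h. h m) \<in> measurable (Pi\<^sub>M {0..<i} (\<lambda>_. count_space UNIV)) (count_space UNIV)"
      using Suc by (intro measurable_component_singleton) auto
    have 2: "(\<lambda>x. measure_pmf (jump \<omega> x)) \<in> measurable (count_space UNIV) (subprob_algebra (count_space UNIV))"
      by (auto simp: space_subprob_algebra intro: prob_space_imp_subprob_space measure_pmf.prob_space_axioms)
    show ?thesis
      using measurable_compose[OF 1 2] Suc by (simp add: walk_kernel_def[abs_def])
  qed
next
  fix i h
  show "prob_space (walk_kernel \<omega> i h)"
    by (auto simp: walk_kernel_def measure_pmf.prob_space_axioms split: nat.split)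
qed

definition path_weight :: "(site \<Rightarrow> site set) \<Rightarrow> (nat \<Rightarrow> site) \<Rightarrow> nat \<Rightarrow> real" where
  "path_weight \<omega> y n =
     (if y 0 = 0 then \<Prod>i<n. pmf (pmf_of_set (\<omega> (y i))) (y (Suc i) - y i) else 0)"

lemma
  shows sets_quenched [measurable_cong]: "sets (quenched \<omega>) = sets path_space"
    and space_quenched [simp]: "space (quenched \<omega>) = UNIV"
    and prob_space_quenched: "prob_space (quenched \<omega>)"
    and emeasure_quenched_path:
      "emeasure (quenched \<omega>) {x. \<forall>i\<le>n. x i = y i} = ennreal (path_weight \<omega> y n)"
proof -
  interpret Ionescu_Tulcea "walk_kernel \<omega>" "\<lambda>_. count_space UNIV"
    by (rule walk_Ionescu_Tulcea)
  have q: "quenched \<omega> = PF.lim"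
    by (simp add: quenched_def)
  show 1: "sets (quenched \<omega>) = sets path_space"
    by (simp add: q)
  show sp: "space (quenched \<omega>) = UNIV"
    using sets_eq_imp_space_eq[OF 1] by simp
  have S: "Pi\<^sub>E {0..<n} (\<lambda>i. {y i}) \<in> sets (Pi\<^sub>M {0..<n} (\<lambda>_. count_space UNIV))" for n
    by (intro sets_PiM_I_finite) auto
  have C: "emeasure (C 0 (Suc n) (\<lambda>_. undefined)) (Pi\<^sub>E {0..<Suc n} (\<lambda>i. {y i}))
    = emeasure (C 0 n (\<lambda>_. undefined)) (Pi\<^sub>E {0..<n} (\<lambda>i. {y i})) * emeasure (walk_kernel \<omega> n y) {y n}" for n
  proof -
    let ?u = "\<lambda>_::nat. undefined :: site"
    let ?c = "count_space UNIV :: site measure"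
    have u: "?u \<in> space (Pi\<^sub>M {0..<0} (\<lambda>_. ?c))"
      by (simp add: space_PiM)
    have spc: "space (C 0 n ?u) = space (Pi\<^sub>M {0..<n} (\<lambda>_. ?c))"
      using space_C[OF u, of n] by simp
    have setc: "sets (C 0 n ?u) = sets (Pi\<^sub>M {0..<n} (\<lambda>_. ?c))"
      using sets_C[OF u, of n] by simp
    have ne: "space (C 0 n ?u) \<noteq> {}"
      using prob_space.not_empty[OF prob_space_C[OF u, of n]] .
    have m: "eP n \<in> measurable (C 0 n ?u) (subprob_algebra (Pi\<^sub>M {0..<Suc n} (\<lambda>_. ?c)))"
      using measurable_eP[of n] measurable_cong_sets[OF setc refl] by blast
    have "emeasure (C 0 (Suc n) ?u) (Pi\<^sub>E {0..<Suc n} (\<lambda>i. {y i}))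
      = (\<integral>\<^sup>+h. emeasure (eP n h) (Pi\<^sub>E {0..<Suc n} (\<lambda>i. {y i})) \<partial>C 0 n ?u)"
      using emeasure_bind[OF ne m S[of "Suc n"]] by simp
    also have "\<dots> = (\<integral>\<^sup>+h. emeasure (walk_kernel \<omega> n y) {y n} * indicator (Pi\<^sub>E {0..<n} (\<lambda>i. {y i})) h \<partial>C 0 n ?u)"
    proof (rule nn_integral_cong)
      fix h assume "h \<in> space (C 0 n ?u)"
      then have h: "h \<in> space (Pi\<^sub>M {0..<n} (\<lambda>_. ?c))"
        using spc by simp
      then have hu: "h i = undefined" if "i \<ge> n" for i
        using that by (auto simp: space_PiM PiE_def extensional_def)
      have "emeasure (eP n h) (Pi\<^sub>E {0..<Suc n} (\<lambda>i. {y i}))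
        = emeasure (walk_kernel \<omega> n h) ((\<lambda>x. fun_upd h n x) -` (Pi\<^sub>E {0..<Suc n} (\<lambda>i. {y i})) \<inter> UNIV)"
        using emeasure_eP[OF h S[of "Suc n"]] by simp
      also have "\<dots> = emeasure (walk_kernel \<omega> n y) {y n} * indicator (Pi\<^sub>E {0..<n} (\<lambda>i. {y i})) h"
      proof (cases "h \<in> Pi\<^sub>E {0..<n} (\<lambda>i. {y i})")
        case True
        then have hi: "h i = y i" if "i < n" for i
          using that by (auto simp: PiE_iff)
        have "(\<lambda>x. fun_upd h n x) -` (Pi\<^sub>E {0..<Suc n} (\<lambda>i. {y i})) \<inter> UNIV = {y n}"
          proof -
          have "h(n := z) \<in> Pi\<^sub>E {0..<Suc n} (\<lambda>i. {y i}) \<longleftrightarrow> z = y n" for z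
            using hi hu by (auto simp: PiE_iff extensional_def less_Suc_eq simp del: split_paired_All)
          then show ?thesis
            by blast
        qed
        moreover have "walk_kernel \<omega> n h = walk_kernel \<omega> n y"
          using hi by (auto simp: walk_kernel_def split: nat.split)
        ultimately show ?thesis
          using True by simp
      next
        case False
        then obtain i where "i < n" "h i \<noteq> y i"
          using h by (auto simp: space_PiM PiE_iff)
        then have "(\<lambda>x. fun_upd h n x) -` (Pi\<^sub>E {0..<Suc n} (\<lambda>i. {y i})) \<inter> UNIV = {}"
          by (auto simp: PiE_iff dest!: bspec[where x = i] simp del: split_paired_All)
        then show ?thesis
          using False by simp
      qed
      finally show "emeasure (eP n h) (Pi\<^sub>E {0..<Suc n} (\<lambda>i. {y i}))
        = emeasure (walk_kernel \<omega> n y) {y n} * indicator (Pi\<^sub>E {0..<n} (\<lambda>i. {y i})) h" .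
    qed
    also have "\<dots> = emeasure (walk_kernel \<omega> n y) {y n} * emeasure (C 0 n ?u) (Pi\<^sub>E {0..<n} (\<lambda>i. {y i}))"
      using S[of n] setc by (intro nn_integral_cmult_indicator) auto
    finally show ?thesis
      by (simp add: mult.commute)
  qed
  have w: "emeasure (C 0 (Suc n) (\<lambda>_. undefined)) (Pi\<^sub>E {0..<Suc n} (\<lambda>i. {y i})) = ennreal (path_weight \<omega> y n)" for n
  proof (induction n)
    case 0
    have "emeasure (C 0 0 (\<lambda>_. undefined)) (Pi\<^sub>E {0..<0} (\<lambda>i. {y i})) = 1"
      using S[of 0] by (simp add: emeasure_return)
    then show ?case
      unfolding C by (simp add: walk_kernel_def path_weight_def emeasure_pmf_single)
  next
    case (Suc n)
    have "emeasure (walk_kernel \<omega> (Suc n) y) {y (Suc n)} =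
      ennreal (pmf (pmf_of_set (\<omega> (y n))) (y (Suc n) - y n))"
      by (simp add: walk_kernel_def emeasure_pmf_single pmf_jump)
    then show ?case
      unfolding C[of "Suc n"] Suc
      by (simp add: path_weight_def ennreal_mult prod_nonneg)
  qed
  have e: "prod_emb UNIV (\<lambda>_. count_space UNIV) {0..<Suc n} (Pi\<^sub>E {0..<Suc n} (\<lambda>i. {y i}))
      = {x. \<forall>i\<le>n. x i = y i}"
    by (auto simp: prod_emb_def PiE_iff space_PiM)
  have "emeasure (quenched \<omega>) {x. \<forall>i\<le>n. x i = y i} = emeasure (CI {0..<Suc n}) (Pi\<^sub>E {0..<Suc n} (\<lambda>i. {y i}))"
    unfolding q e[symmetric] by (rule lim[OF _ S]) simp
  also have "\<dots> = emeasure (C 0 (Suc n) (\<lambda>_. undefined))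
      (prod_emb {0..<Suc n} (\<lambda>_. count_space UNIV) {0..<Suc n} (Pi\<^sub>E {0..<Suc n} (\<lambda>i. {y i})))"
    by (rule emeasure_CI[OF _ S]) simp
  also have "prod_emb {0..<Suc n} (\<lambda>_. count_space UNIV) {0..<Suc n} (Pi\<^sub>E {0..<Suc n} (\<lambda>i. {y i}))
      = Pi\<^sub>E {0..<Suc n} (\<lambda>i. {y i})"
    using sets.sets_into_space[OF S[of "Suc n"]] by (rule prod_emb_id[OF subset_trans]) (simp add: space_PiM)
  finally show "emeasure (quenched \<omega>) {x. \<forall>i\<le>n. x i = y i} = ennreal (path_weight \<omega> y n)"
    unfolding w .
  show "prob_space (quenched \<omega>)"
  proof
    have "emeasure PF.lim (prod_emb UNIV (\<lambda>_. count_space UNIV) {} {\<lambda>_. undefined}) = emeasure (CI {}) {\<lambda>_. undefined}"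
      by (rule lim) (auto simp: PiM_empty)
    also have "prod_emb UNIV (\<lambda>_. count_space UNIV) {} {\<lambda>_. undefined} = (UNIV :: (nat \<Rightarrow> site) set)"
      by (auto simp: prod_emb_def space_PiM restrict_def)
    also have "emeasure (CI {}) {\<lambda>_. undefined} = 1"
      using prob_space.emeasure_space_1[OF PF.prob_space_P[of "{}"]] PF.space_P[of "{}"]
      by (simp add: space_PiM)
    finally show "emeasure (quenched \<omega>) (space (quenched \<omega>)) = 1"
      by (simp add: q sp[unfolded q])
  qed
qed

lemma sets_path_space_generator:
  "sets path_space = sigma_sets UNIV (insert {} (range (\<lambda>(n, y). {x. \<forall>i\<le>n. x i = y i})))"
    (is "_ = sigma_sets UNIV ?E")
proof
  have "{x. \<forall>i\<le>n. x i = y i} \<in> sets path_space" for n and y :: "nat \<Rightarrow> site"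
  proof -
    have "{x \<in> space path_space. \<forall>i\<in>{..n}. x i = y i} \<in> sets path_space"
      by measurable
    then show ?thesis
      by (simp add: Ball_def)
  qed
  then show "sigma_sets UNIV ?E \<subseteq> sets path_space"
    using sets.sigma_sets_subset[of ?E path_space] by (simp add: image_subset_iff)
next
  have fin: "countable (Pi\<^sub>E {..n} (\<lambda>_. UNIV :: site set))" for n :: nat
    by (intro countable_PiE) auto
  have *: "{f. f i \<in> A} \<in> sigma_sets UNIV ?E" for i and A :: "site set"
  proof -
    let ?I = "{y \<in> Pi\<^sub>E {..i} (\<lambda>_. UNIV :: site set). y i \<in> A}"
    have "{f. f i \<in> A} = (\<Union>y\<in>?I. {x. \<forall>j\<le>i. x j = y j})"
    proof (intro set_eqI iffI)
      fix x assume "x \<in> {f. f i \<in> A}"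
      then have "restrict x {..i} \<in> ?I" "x \<in> {z. \<forall>j\<le>i. z j = restrict x {..i} j}"
        by auto
      then show "x \<in> (\<Union>y\<in>?I. {x. \<forall>j\<le>i. x j = y j})"
        by blast
    qed auto
    moreover have "countable ((\<lambda>y. {x. \<forall>j\<le>i. x j = y j}) ` ?I)"
      using fin[of i] by (intro countable_image) (rule countable_subset[rotated], auto)
    then have "\<Union>((\<lambda>y. {x. \<forall>j\<le>i. x j = y j}) ` ?I) \<in> sigma_sets UNIV ?E"
      by (rule sigma_sets_UNION) (force intro: sigma_sets.Basic)
    ultimately show ?thesis
      by simp
  qed
  have "sigma_sets UNIV {{f \<in> UNIV. f i \<in> A} |i A. i \<in> UNIV \<and> A \<in> sets (count_space UNIV)} \<subseteq> sigma_sets UNIV ?E"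
    using * by (intro sigma_sets_mono) auto
  then show "sets path_space \<subseteq> sigma_sets UNIV ?E"
    by (simp add: sets_PiM_single)
qed

lemma measurable_quenched [measurable]: "quenched \<in> measurable env_space (prob_algebra path_space)"
proof (rule measurable_prob_algebra_generated[where \<Omega> = UNIV
      and G = "insert {} (range (\<lambda>(n, y). {x. \<forall>i\<le>n. x i = y i}))"])
  show "sets path_space = sigma_sets UNIV (insert {} (range (\<lambda>(n, y). {x. \<forall>i\<le>n. x i = y i})))"
    by (rule sets_path_space_generator)
  show "Int_stable (insert {} (range (\<lambda>(n, y). {x. \<forall>i\<le>n. x i = y i})) :: (nat \<Rightarrow> site) set set)"
  proof (rule Int_stableI)
    have *: "{x. \<forall>i\<le>n. x i = y i} \<inter> {x. \<forall>i\<le>m. x i = z i} \<in>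
      insert {} (range (\<lambda>(n, y). {x. \<forall>i\<le>n. x i = y i}))" for n m and y z :: "nat \<Rightarrow> site"
    proof (cases "\<forall>i\<le>min n m. y i = z i")
      case True
      then have "{x. \<forall>i\<le>n. x i = y i} \<inter> {x. \<forall>i\<le>m. x i = z i} =
        (\<lambda>(n, y). {x. \<forall>i\<le>n. x i = y i}) (if n \<le> m then (m, z) else (n, y))"
        by (auto simp: min_def split: if_splits)
      then show ?thesis
        by blast
    next
      case False
      then have "{x. \<forall>i\<le>n. x i = y i} \<inter> {x. \<forall>i\<le>m. x i = z i} = {}"
        by (auto simp: min_def split: if_splits)
      then show ?thesis
        by blast
    qed
    fix a b :: "(nat \<Rightarrow> site) set"
    assume "a \<in> insert {} (range (\<lambda>(n, y). {x. \<forall>i\<le>n. x i = y i}))"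
      "b \<in> insert {} (range (\<lambda>(n, y). {x. \<forall>i\<le>n. x i = y i}))"
    then consider "a \<inter> b = {}" | n y m z where "a = {x. \<forall>i\<le>n. x i = y i}" "b = {x. \<forall>i\<le>m. x i = z i}"
      by auto
    then show "a \<inter> b \<in> insert {} (range (\<lambda>(n, y). {x. \<forall>i\<le>n. x i = y i}))"
      by cases (simp, simp only: *)
  qed
  show "insert {} (range (\<lambda>(n, y). {x. \<forall>i\<le>n. x i = y i})) \<subseteq> Pow UNIV"
    by simp
  show "prob_space (quenched \<omega>)" for \<omega>
    by (rule prob_space_quenched)
  show "sets (quenched \<omega>) = sets path_space" for \<omega>
    by (rule sets_quenched)
  fix A :: "(nat \<Rightarrow> site) set"
  assume "A \<in> insert {} (range (\<lambda>(n, y). {x. \<forall>i\<le>n. x i = y i}))"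
  then consider "A = {}" | n y where "A = {x. \<forall>i\<le>n. x i = y i}"
    by auto
  then show "(\<lambda>\<omega>. emeasure (quenched \<omega>) A) \<in> borel_measurable env_space"
  proof cases
    case 2
    have "(\<lambda>\<omega>. pmf (pmf_of_set (\<omega> (y i))) (y (Suc i) - y i)) \<in> borel_measurable env_space" for i
      by (rule measurable_compose[OF measurable_component_singleton]) auto
    then have "(\<lambda>\<omega>. path_weight \<omega> y n) \<in> borel_measurable env_space"
      unfolding path_weight_def by (cases "y 0 = 0") auto
    then show ?thesis
      unfolding 2 emeasure_quenched_path by measurable
  qed simp
qed

text \<open>The two lemmas below say that \<open>annealed M G\<close> is the average of the quenched laws over
  the environment.\<close>

lemma prob_space_annealed:
  assumes "prob_space M" and "\<And>x. G x \<in> measurable M (count_space UNIV)"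
  shows "prob_space (annealed M G)" and "sets (annealed M G) = sets path_space"
proof -
  have *: "(\<lambda>w. quenched (\<lambda>x. G x w)) \<in> measurable M (prob_algebra path_space)"
    using assms(2) by (intro measurable_compose[OF _ measurable_quenched] measurable_PiM_single') auto
  have ne: "space M \<noteq> {}"
    using prob_space.not_empty[OF assms(1)] .
  have "prob_space (quenched \<omega>)" for \<omega>
    by (rule prob_space_quenched)
  then show "prob_space (annealed M G)"
    unfolding annealed_def
    by (intro prob_space.prob_space_bind[OF assms(1) _ measurable_prob_algebraD[OF *]]) simp
  show "sets (annealed M G) = sets path_space"
    unfolding annealed_def by (rule sets_bind[OF _ ne]) (rule sets_quenched)
qed

lemma emeasure_annealed:
  assumes "prob_space M" and "\<And>x. G x \<in> measurable M (count_space UNIV)" and "A \<in> sets path_space"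
  shows "emeasure (annealed M G) A = (\<integral>\<^sup>+w. emeasure (quenched (\<lambda>x. G x w)) A \<partial>M)"
proof -
  have *: "(\<lambda>w. quenched (\<lambda>x. G x w)) \<in> measurable M (prob_algebra path_space)"
    using assms(2) by (intro measurable_compose[OF _ measurable_quenched] measurable_PiM_single') auto
  show ?thesis
    unfolding annealed_def
    by (rule emeasure_bind[OF prob_space.not_empty[OF assms(1)] measurable_prob_algebraD[OF *] assms(3)])
qed

end

theory Submission
  imports Defs
begin

text \<open>Write \<open>m\<close> for the mean, over the environment, of the quenched expectation \<open>h(x)\<close> of the time
  spent in the row of \<open>x\<close> before stepping down. Given the environment, \<open>h\<close> solves
  \<open>3 (h - 3)(x) = (h - 3)(x + e1) + (h - 3)(x - e1)\<close> at a three-step site, while a two-step site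
  can only be left to the left; so the row splits into blocks between consecutive two-step sites,
  on which \<open>h - 3\<close> is an explicit combination of powers of \<open>gam\<close>. Averaging over the geometric
  block length gives \<open>m\<close> in terms of \<open>Theta\<close>.

  For the velocity, \<open>h\<close> is used as a corrector. With \<open>X\<^sub>n = (x\<^sub>n, y\<^sub>n)\<close>, the increments of
  \<open>n + h(X\<^sub>n) - h(X\<^sub>0) + m y\<^sub>n\<close> are orthogonal to its past under the annealed law, because a step
  down enters a row whose environment is independent of everything above, and \<open>x\<^sub>n - 3 y\<^sub>n - n\<close>
  is a martingale in every environment. Both processes have bounded increments, so their variances grow linearly; along
  squares this is summable after normalisation, and bounded increments fill the gaps.\<close>

section \<open>Product measures on two-valued environments\<close>

text \<open>Averaging over a block does not give \<open>m\<close> at once: on a block,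
  \<open>h - 3\<close> still involves its value at the two-step site on the left end. That value is
  a function of the sites at and to the left of this end, hence independent of the block. Let
  \<open>kappa p\<close> be the mean of \<open>h - 3\<close> at the origin on the event that the
  origin is a two-step site. Going back to the preceding two-step site expresses
  \<open>kappa p\<close> through itself, by stationarity, in an affine equation
  \<open>kappa = q * a * kappa - q^2 * b\<close> with \<open>q = 1 - p\<close> and series
  \<open>a\<close>, \<open>b\<close> over the block length. The factor \<open>1 - q * a\<close> is
  the denominator in the theorem. The powers of \<open>gam\<close> enter because \<open>gam\<close>
  and \<open>1 / gam\<close> are the roots of \<open>z^2 = 3 * z - 1\<close>, the characteristic
  equation at three-step sites. For the velocity, the decisive point is that the corrector
  \<open>h\<close> is bounded by 3 in every environment. Second moments then suffice, and neither
  regeneration times nor the environment seen from the walk are used.\<close>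

definition bern :: "real \<Rightarrow> ('i \<Rightarrow> bool) measure" where
  "bern p = Pi\<^sub>M UNIV (\<lambda>_. measure_pmf (bernoulli_pmf p))"

text \<open>Stands for measurability with respect to the coordinates in \<open>S\<close>, so that
  independence of rows and of half-lines can be used without introducing sub-sigma-algebras.\<close>

definition depends_on :: "'i set \<Rightarrow> (('i \<Rightarrow> bool) \<Rightarrow> 'b) \<Rightarrow> bool" where
  "depends_on S f \<longleftrightarrow> (\<forall>t t'. (\<forall>i\<in>S. t i = t' i) \<longrightarrow> f t = f t')"

lemma depends_onI: "(\<And>t t'. (\<And>i. i \<in> S \<Longrightarrow> t i = t' i) \<Longrightarrow> f t = f t') \<Longrightarrow> depends_on S f"
  unfolding depends_on_def by blast

lemma depends_onD: "depends_on S f \<Longrightarrow> (\<And>i. i \<in> S \<Longrightarrow> t i = t' i) \<Longrightarrow> f t = f t'"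
  unfolding depends_on_def by blast

lemma space_bern [simp]: "space (bern p) = UNIV"
  by (simp add: bern_def space_PiM)

lemma prob_space_bern: "prob_space (bern p)"
  unfolding bern_def by (intro prob_space_PiM measure_pmf.prob_space_axioms)

lemma measure_bern_UNIV [simp]: "measure (bern p) UNIV = 1"
  using prob_space.prob_space[OF prob_space_bern[of p]] by simp

lemma sets_bern [measurable_cong]: "sets (bern p) = sets (Pi\<^sub>M UNIV (\<lambda>_. count_space UNIV))"
  unfolding bern_def by (rule sets_PiM_cong) auto

lemma measurable_bern_component [measurable]: "(\<lambda>t. t i) \<in> measurable (bern p) (count_space UNIV)"
proof -
  have "(\<lambda>t. t i) \<in> measurable (Pi\<^sub>M UNIV (\<lambda>_. count_space UNIV)) (count_space UNIV)"
    by measurable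
  then show ?thesis
    using measurable_cong_sets[OF sets_bern refl] by blast
qed

lemma measurable_bern_reindex [measurable]: "(\<lambda>t i. t (f i)) \<in> measurable (bern p) (bern p)"
proof -
  have "(\<lambda>t i. t (f i)) \<in> measurable (bern p) (Pi\<^sub>M UNIV (\<lambda>_. count_space UNIV))"
    by (rule measurable_PiM_single') auto
  then show ?thesis
    using measurable_cong_sets[OF refl sets_bern] by blast
qed

lemma distr_bern_reindex:
  assumes "inj f"
  shows "distr (bern p) (bern p) (\<lambda>t i. t (f i)) = bern p"
  using distr_PiM_reindex[of UNIV "\<lambda>_. measure_pmf (bernoulli_pmf p)" f UNIV] assms
  by (simp add: bern_def measure_pmf.prob_space_axioms restrict_def)

text \<open>Stated for an arbitrary injection, so that it serves translations and the reflection of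
  a row as well as the embedding of a row into the plane.\<close>

lemma integral_bern_reindex:
  fixes g :: "('i \<Rightarrow> bool) \<Rightarrow> real"
  assumes "inj f" and g: "g \<in> borel_measurable (bern p)"
  shows "(\<integral>t. g (\<lambda>i. t (f i)) \<partial>bern p) = (\<integral>t. g t \<partial>bern p)"
  using integral_distr[OF measurable_bern_reindex[of f p] g] distr_bern_reindex[OF assms(1), of p]
  by simp

lemma integrable_bern:
  fixes f :: "('i \<Rightarrow> bool) \<Rightarrow> real"
  assumes "f \<in> borel_measurable (bern p)" "\<And>t. \<bar>f t\<bar> \<le> C"
  shows "integrable (bern p) f"
proof -
  interpret prob_space "bern p :: ('i \<Rightarrow> bool) measure" by (rule prob_space_bern)
  show ?thesis using assms by (intro integrable_const_bound[of _ C]) auto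
qed

lemma distr_bern_component:
  "distr (bern p) (count_space UNIV) (\<lambda>t :: 'i \<Rightarrow> bool. t i) = measure_pmf (bernoulli_pmf p)"
proof -
  have "distr (Pi\<^sub>M UNIV (\<lambda>_::'i. measure_pmf (bernoulli_pmf p))) (measure_pmf (bernoulli_pmf p)) (\<lambda>t. t i)
    = measure_pmf (bernoulli_pmf p)"
    by (rule distr_PiM_component) (auto simp: measure_pmf.prob_space_axioms)
  moreover have "distr (bern p) (count_space UNIV) (\<lambda>t :: 'i \<Rightarrow> bool. t i)
    = distr (Pi\<^sub>M UNIV (\<lambda>_::'i. measure_pmf (bernoulli_pmf p))) (measure_pmf (bernoulli_pmf p)) (\<lambda>t. t i)"
    unfolding bern_def by (rule distr_cong) auto
  ultimately show ?thesis
    by simp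
qed

lemma indep_vars_bern:
  "prob_space.indep_vars (bern p :: ('i \<Rightarrow> bool) measure) (\<lambda>_. count_space UNIV) (\<lambda>i t. t i) UNIV"
proof -
  interpret prob_space "bern p :: ('i \<Rightarrow> bool) measure" by (rule prob_space_bern)
  have "distr (bern p) (Pi\<^sub>M UNIV (\<lambda>_. count_space UNIV)) (\<lambda>t :: 'i \<Rightarrow> bool. t) = bern p"
    by (rule distr_id2) (simp add: sets_bern)
  moreover have "(\<Pi>\<^sub>M i\<in>UNIV. distr (bern p) (count_space UNIV) (\<lambda>t :: 'i \<Rightarrow> bool. t i)) = bern p"
    unfolding distr_bern_component by (simp add: bern_def)
  ultimately show ?thesis
    by (subst indep_vars_iff_distr_eq_PiM) (simp_all add: restrict_UNIV)
qed

lemma integral_bern_mult: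
  fixes f g :: "('i \<Rightarrow> bool) \<Rightarrow> real"
  assumes f: "f \<in> borel_measurable (bern p)" "\<And>t. \<bar>f t\<bar> \<le> C" "depends_on S f"
    and g: "g \<in> borel_measurable (bern p)" "\<And>t. \<bar>g t\<bar> \<le> D" "depends_on S' g"
    and S: "S \<inter> S' = {}"
  shows "(\<integral>t. f t * g t \<partial>bern p) = (\<integral>t. f t \<partial>bern p) * (\<integral>t. g t \<partial>bern p)"
proof -
  interpret prob_space "bern p :: ('i \<Rightarrow> bool) measure" by (rule prob_space_bern)
  define K where "K b = (if b then S else S')" for b
  define r where "r b t = restrict t (K b)" for b and t :: "'i \<Rightarrow> bool"
  have iv: "indep_vars (\<lambda>b. Pi\<^sub>M (K b) (\<lambda>_. count_space UNIV)) r UNIV"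
    unfolding r_def by (rule indep_vars_restrict[OF indep_vars_bern])
      (use S in \<open>auto simp: disjoint_family_on_def K_def\<close>)
  \<comment> \<open>Restrictions only live on \<open>K b\<close>. Extending them by a default value,
    here \<open>False\<close>, gives back arguments for \<open>f\<close> and \<open>g\<close>, whose
    values do not change because they ignore the coordinates outside \<open>S\<close> and
    \<open>S'\<close>.\<close>
  define ext where "ext b u = (\<lambda>i. if i \<in> K b then u i else False)" for b and u :: "'i \<Rightarrow> bool"
  have ext_m: "ext b \<in> measurable (Pi\<^sub>M (K b) (\<lambda>_. count_space UNIV)) (bern p)" for b
  proof -
    have *: "(\<lambda>u. ext b u i) \<in> measurable (Pi\<^sub>M (K b) (\<lambda>_. count_space UNIV)) (count_space UNIV)" for i
      by (cases "i \<in> K b") (auto simp: ext_def intro!: measurable_component_singleton)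
    have "(\<lambda>u i. ext b u i) \<in> measurable (Pi\<^sub>M (K b) (\<lambda>_. count_space UNIV)) (Pi\<^sub>M UNIV (\<lambda>_. count_space UNIV))"
      by (rule measurable_PiM_single', rule *) auto
    then show ?thesis
      using measurable_cong_sets[OF refl sets_bern] by blast
  qed
  define F where "F b u = (if b then f else g) (ext b u)" for b u
  have F_m: "F b \<in> borel_measurable (Pi\<^sub>M (K b) (\<lambda>_. count_space UNIV))" for b
    using measurable_compose[OF ext_m[of b] f(1)] measurable_compose[OF ext_m[of b] g(1)]
    by (cases b) (simp_all only: F_def[abs_def] if_True if_False)
  have "f (ext True (r True t)) = f t" "g (ext False (r False t)) = g t" for t
    by (rule depends_onD[OF f(3)], simp add: ext_def r_def K_def,
        rule depends_onD[OF g(3)], simp add: ext_def r_def K_def)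
  then have fr: "F True (r True t) = f t" and gr: "F False (r False t) = g t" for t
    by (simp_all add: F_def)
  have "indep_vars (\<lambda>_. borel) (\<lambda>b t. F b (r b t)) UNIV"
    by (rule indep_vars_compose2[OF iv F_m])
  moreover have "integrable (bern p) (\<lambda>t. F b (r b t))" for b
    using integrable_bern[OF f(1,2)] integrable_bern[OF g(1,2)] by (cases b) (simp_all add: fr gr)
  ultimately have "expectation (\<lambda>t. \<Prod>b\<in>UNIV. F b (r b t)) = (\<Prod>b\<in>UNIV. expectation (\<lambda>t. F b (r b t)))"
    by (intro indep_vars_lebesgue_integral) simp
  then show ?thesis
    unfolding UNIV_bool by (simp add: fr gr mult.commute)
qed

lemma integral_bern_component:
  fixes i :: 'i
  assumes "0 \<le> p" "p \<le> 1"
  shows "(\<integral>t. of_bool (t i) \<partial>bern p) = p"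
proof -
  have "(\<integral>b. of_bool b \<partial>distr (bern p) (count_space UNIV) (\<lambda>t :: 'i \<Rightarrow> bool. t i))
      = (\<integral>t. of_bool (t i) \<partial>(bern p :: ('i \<Rightarrow> bool) measure) :: real)"
    by (rule integral_distr[OF measurable_bern_component]) simp
  then show ?thesis
    unfolding distr_bern_component by (simp add: assms)
qed

section \<open>One row of the environment\<close>

text \<open>Transition operator of the walk inside a row, killed at the step down: the missing mass,
  \<open>1/3\<close> or \<open>1/2\<close>, is the probability of leaving the row. Its
  \<open>k\<close>-th power applied to the constant 1 is the probability of still being in the row
  after \<open>k\<close> steps, and summing over \<open>k\<close> gives the expected time
  \<open>row_time\<close>.\<close>

definition row_step :: "(int \<Rightarrow> bool) \<Rightarrow> (int \<Rightarrow> real) \<Rightarrow> int \<Rightarrow> real" where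
  "row_step r f i = (if r i then (f (i + 1) + f (i - 1)) / 3 else f (i - 1) / 2)"

definition row_survival :: "(int \<Rightarrow> bool) \<Rightarrow> nat \<Rightarrow> int \<Rightarrow> real" where
  "row_survival r k = (row_step r ^^ k) (\<lambda>_. 1)"

definition row_time :: "(int \<Rightarrow> bool) \<Rightarrow> int \<Rightarrow> real" where
  "row_time r i = (\<Sum>k. row_survival r k i)"

lemma row_survival_0 [simp]: "row_survival r 0 i = 1"
  by (simp add: row_survival_def)

lemma row_survival_Suc: "row_survival r (Suc k) i = row_step r (row_survival r k) i"
  by (simp add: row_survival_def)

text \<open>At most \<open>2/3\<close> of the mass survives a step at either kind of site; this
  makes the series converge and caps \<open>row_time\<close> at 3.\<close>

lemma row_survival_bounds: "0 \<le> row_survival r k i \<and> row_survival r k i \<le> (2/3) ^ k"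
proof (induction k arbitrary: i)
  case (Suc k)
  show ?case
    using Suc[of "i + 1"] Suc[of "i - 1"] by (auto simp: row_survival_Suc row_step_def)
qed simp

lemma summable_row_survival: "summable (\<lambda>k. row_survival r k i)"
  by (rule summable_comparison_test'[OF summable_geometric[of "2/3 :: real"]])
    (use row_survival_bounds in auto)

lemma row_time_bounds: "0 \<le> row_time r i" "row_time r i \<le> 3"
proof -
  show "0 \<le> row_time r i"
    unfolding row_time_def using row_survival_bounds by (intro suminf_nonneg summable_row_survival) auto
  have "row_time r i \<le> (\<Sum>k. (2/3 :: real) ^ k)"
    unfolding row_time_def using row_survival_bounds
    by (intro suminf_le summable_row_survival summable_geometric) auto
  then show "row_time r i \<le> 3"
    by (simp add: suminf_geometric)
qed

lemma row_time_eq: "row_time r i = 1 + row_step r (row_time r) i"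
proof -
  have "row_time r i = 1 + (\<Sum>k. row_step r (row_survival r k) i)"
    unfolding row_time_def
    using suminf_split_head[OF summable_row_survival[of r i]] by (simp add: row_survival_Suc)
  also have "(\<Sum>k. row_step r (row_survival r k) i) = row_step r (row_time r) i"
  proof (cases "r i")
    case True
    have "(\<lambda>k. (row_survival r k (i + 1) + row_survival r k (i - 1)) / 3) sums
      ((row_time r (i + 1) + row_time r (i - 1)) / 3)"
      unfolding row_time_def by (intro sums_divide sums_add summable_sums summable_row_survival)
    then show ?thesis
      using True by (simp add: row_step_def sums_iff)
  next
    case False
    have "(\<lambda>k. row_survival r k (i - 1) / 2) sums (row_time r (i - 1) / 2)"
      unfolding row_time_def by (intro sums_divide summable_sums summable_row_survival)
    then show ?thesis
      using False by (simp add: row_step_def sums_iff)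
  qed
  finally show ?thesis .
qed

lemma measurable_row_time [measurable]: "(\<lambda>r. row_time r i) \<in> borel_measurable (bern p)"
proof -
  have [measurable]: "(\<lambda>r. row_survival r k i) \<in> borel_measurable (bern p)" for k i
  proof (induction k arbitrary: i)
    case (Suc k)
    note [measurable] = Suc
    show ?case
      unfolding row_survival_Suc row_step_def by measurable
  qed simp
  show ?thesis
    unfolding row_time_def by measurable
qed

lemma row_time_shift: "row_time (\<lambda>j. r (j + a)) i = row_time r (i + a)"
proof -
  have "row_survival (\<lambda>j. r (j + a)) k i = row_survival r k (i + a)" for k
    by (induction k arbitrary: i) (simp_all add: row_survival_Suc row_step_def algebra_simps)
  then show ?thesis
    by (simp add: row_time_def)
qed

text \<open>A two-step site is never left to the right, hence shields the sites to its left from the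
  environment to its right.\<close>

lemma row_time_cong_left:
  assumes "\<And>j. j \<le> x \<Longrightarrow> r j = r' j" "\<not> r x" "y \<le> x"
  shows "row_time r y = row_time r' y"
proof -
  have "row_survival r k y = row_survival r' k y" if "y \<le> x" for k
    using that
  proof (induction k arbitrary: y)
    case (Suc k)
    have "r y = r' y" using assms(1) Suc.prems by blast
    moreover have "y + 1 \<le> x" if "r y"
      using that assms(2) Suc.prems by (cases "y = x") auto
    ultimately show ?case
      using Suc.IH[of "y + 1"] Suc.IH[of "y - 1"] Suc.prems
      by (auto simp: row_survival_Suc row_step_def)
  qed simp
  then show ?thesis
    using assms(3) by (simp add: row_time_def)
qed

section \<open>Explicit solution on a block between consecutive two-step sites\<close>

fun even_fib :: "nat \<Rightarrow> real" where
  "even_fib 0 = 0"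
| "even_fib (Suc 0) = 1"
| "even_fib (Suc (Suc n)) = 3 * even_fib (Suc n) - even_fib n"

text \<open>With Fibonacci numbers \<open>F\<close>, \<open>even_fib n\<close> is
  \<open>F (2 * n)\<close> and \<open>block_den n\<close> is \<open>F (2 * n + 3)\<close>. The
  latter is the coefficient of \<open>w 1\<close> once the equation at the right end of a block with
  \<open>n\<close> interior sites is imposed.\<close>

definition block_den :: "nat \<Rightarrow> real" where
  "block_den n = 2 * even_fib (Suc n) - even_fib n"

lemma even_fib_growth: "0 \<le> even_fib n \<and> even_fib n + 1 \<le> even_fib (Suc n)"
  by (induction n) auto

lemma block_den_ge: "2 \<le> block_den n" "even_fib (Suc n) \<le> block_den n" "even_fib n \<le> block_den n"
  using even_fib_growth[of n] by (auto simp: block_den_def)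

text \<open>A Cassini-type identity: the quadratic form is preserved by the recurrence and equals 1
  at \<open>n = 0\<close>. It collapses the coefficient of \<open>w 0\<close> in the second formula
  of \<open>block_solution\<close>.\<close>

lemma even_fib_invariant: "even_fib (Suc n) ^ 2 + even_fib n ^ 2 - 3 * even_fib n * even_fib (Suc n) = 1"
  by (induction n) (auto simp: algebra_simps power2_eq_square)

text \<open>The recurrence propagates \<open>w 0\<close> and \<open>w 1\<close> through the block,
  and the equation at the right end \<open>n + 1\<close> fixes \<open>w 1\<close>. The value
  \<open>w 0\<close> stays as a parameter, since the equation at the left end refers to the
  neighbouring block.\<close>

lemma block_solution:
  fixes w :: "int \<Rightarrow> real"
  assumes inner: "\<And>i. 1 \<le> i \<Longrightarrow> i \<le> int n \<Longrightarrow> 3 * w i = w (i + 1) + w (i - 1)"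
    and last: "2 * w (int n + 1) = w (int n) - 1"
  shows "w 1 = (w 0 * (even_fib (Suc n) - even_fib n) - 1) / block_den n"
    and "w (int n + 1) = (w 0 - even_fib (Suc n)) / block_den n"
proof -
  \<comment> \<open>Two consecutive values are carried along; the coefficient
    \<open>even_fib (k - 1)\<close> is written as \<open>3 * even_fib k - even_fib (Suc k)\<close>,
    which is also correct at \<open>k = 0\<close>.\<close>
  have "w (int k + 1) = even_fib (Suc k) * w 1 - even_fib k * w 0 \<and>
      w (int k) = even_fib k * w 1 - (3 * even_fib k - even_fib (Suc k)) * w 0" if "k \<le> n" for k
    using that
  proof (induction k)
    case (Suc k)
    then have "w (int k + 1) = even_fib (Suc k) * w 1 - even_fib k * w 0"
      "w (int k) = even_fib k * w 1 - (3 * even_fib k - even_fib (Suc k)) * w 0"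
      by simp_all
    moreover have "3 * w (int k + 1) = w (int k + 1 + 1) + w (int k)"
      using inner[of "int k + 1"] Suc.prems by simp
    ultimately show ?case
      by (simp add: algebra_simps)
  qed simp
  from this[of n] have
    1: "w (int n + 1) = even_fib (Suc n) * w 1 - even_fib n * w 0" and
    2: "w (int n) = even_fib n * w 1 - (3 * even_fib n - even_fib (Suc n)) * w 0"
    by simp_all
  have d: "block_den n \<noteq> 0"
    using block_den_ge(1)[of n] by simp
  have 3: "w 1 * block_den n = w 0 * (even_fib (Suc n) - even_fib n) - 1"
    using last unfolding 1 2 block_den_def by (simp add: algebra_simps)
  then show "w 1 = (w 0 * (even_fib (Suc n) - even_fib n) - 1) / block_den n"
    using d by (simp add: field_simps)
  have "w (int n + 1) * block_den n =
      even_fib (Suc n) * (w 1 * block_den n) - even_fib n * w 0 * block_den n"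
    unfolding 1 by (simp add: algebra_simps)
  also have "\<dots> = w 0 * (even_fib (Suc n) ^ 2 + even_fib n ^ 2 - 3 * even_fib n * even_fib (Suc n)) - even_fib (Suc n)"
    unfolding 3 unfolding block_den_def by (simp add: algebra_simps power2_eq_square)
  finally show "w (int n + 1) = (w 0 - even_fib (Suc n)) / block_den n"
    using d unfolding even_fib_invariant by (simp add: field_simps)
qed

text \<open>The constant 3 solves \<open>h = 1 + (h + h) / 3\<close>, so subtracting it makes the
  three-step equation homogeneous; only two-step sites keep a source term.\<close>

definition row_excess :: "(int \<Rightarrow> bool) \<Rightarrow> int \<Rightarrow> real" where
  "row_excess r i = row_time r i - 3"

lemma row_excess_three: "r i \<Longrightarrow> 3 * row_excess r i = row_excess r (i + 1) + row_excess r (i - 1)"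
  using row_time_eq[of r i] by (simp add: row_excess_def row_step_def)

lemma row_excess_two: "\<not> r i \<Longrightarrow> 2 * row_excess r i = row_excess r (i - 1) - 1"
  using row_time_eq[of r i] by (simp add: row_excess_def row_step_def)

lemma abs_row_excess: "\<bar>row_excess r i\<bar> \<le> 3"
  using row_time_bounds[of r i] by (simp add: row_excess_def)

lemma measurable_row_excess [measurable]: "(\<lambda>r. row_excess r i) \<in> borel_measurable (bern p)"
  unfolding row_excess_def by measurable

lemma row_excess_shift: "row_excess (\<lambda>j. r (j + a)) i = row_excess r (i + a)"
  by (simp add: row_excess_def row_time_shift)

section \<open>Decomposition according to the nearest two-step site\<close>

definition run_to :: "(int \<Rightarrow> bool) \<Rightarrow> nat \<Rightarrow> real" where
  "run_to r n = (\<Prod>i\<in>{1..n}. of_bool (r (int i)))"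

text \<open>Indicator that the first two-step site to the right of the origin is
  \<open>n + 1\<close>, so \<open>n\<close> counts the three-step sites in between. The difference
  form in \<open>block_right_eq\<close> makes sums over \<open>n\<close> telescope.\<close>

definition block_right :: "(int \<Rightarrow> bool) \<Rightarrow> nat \<Rightarrow> real" where
  "block_right r n = run_to r n * of_bool (\<not> r (int n + 1))"

lemma run_to_Suc: "run_to r (Suc n) = run_to r n * of_bool (r (int n + 1))"
  by (simp add: run_to_def prod.nat_ivl_Suc' mult.commute add.commute)

lemma run_to_0 [simp]: "run_to r 0 = 1"
  by (simp add: run_to_def)

lemma run_to_01: "0 \<le> run_to r n" "run_to r n \<le> 1"
  by (induction n) (simp_all add: run_to_Suc)

lemma run_to_eq: "run_to r n = of_bool (\<forall>i. 1 \<le> i \<and> i \<le> int n \<longrightarrow> r i)"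
proof (induction n)
  case (Suc n)
  have "(\<forall>i. 1 \<le> i \<and> i \<le> int (Suc n) \<longrightarrow> r i) \<longleftrightarrow> (\<forall>i. 1 \<le> i \<and> i \<le> int n \<longrightarrow> r i) \<and> r (int n + 1)"
    by (auto simp: le_less_trans) (smt (verit))
  then show ?case
    unfolding run_to_Suc Suc by simp
qed auto

lemma block_right_eq: "block_right r n = run_to r n - run_to r (Suc n)"
  by (simp add: block_right_def run_to_Suc)

lemma abs_block_right: "\<bar>block_right r n\<bar> \<le> 1"
  using run_to_01[of r n] by (simp add: block_right_def)

lemma measurable_run_to [measurable]: "(\<lambda>r. run_to r n) \<in> borel_measurable (bern p)"
  unfolding run_to_def by measurable

lemma measurable_block_right [measurable]: "(\<lambda>r. block_right r n) \<in> borel_measurable (bern p)"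
  unfolding block_right_eq by measurable

lemma depends_on_block_right: "depends_on {1..} (\<lambda>r. block_right r n)"
  by (rule depends_onI) (simp add: block_right_def run_to_def)

lemma integral_bern_component_not:
  assumes "0 \<le> p" "p \<le> 1"
  shows "(\<integral>r. of_bool (\<not> r i) \<partial>bern p) = 1 - p"
proof -
  have "(\<integral>r. of_bool (\<not> r i) \<partial>bern p) = (\<integral>r. 1 - of_bool (r i) \<partial>(bern p :: ('a \<Rightarrow> bool) measure))"
    by (intro Bochner_Integration.integral_cong) auto
  also have "\<dots> = 1 - p"
    using integral_bern_component[OF assms, of i]
    by (subst Bochner_Integration.integral_diff) (auto intro!: integrable_bern[where C = 1])
  finally show ?thesis .
qed

lemma integral_run_to:
  assumes "0 \<le> p" "p \<le> 1"
  shows "(\<integral>r. run_to r n \<partial>bern p) = p ^ n"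
proof (induction n)
  case 0
  show ?case by simp
next
  case (Suc n)
  have "(\<integral>r. run_to r n * of_bool (r (int n + 1)) \<partial>bern p)
    = (\<integral>r. run_to r n \<partial>bern p) * (\<integral>r. of_bool (r (int n + 1)) \<partial>bern p)"
    by (rule integral_bern_mult[where S = "{..int n}" and S' = "{int n + 1}" and C = 1 and D = 1])
      (use run_to_01 in \<open>auto intro!: depends_onI simp: run_to_def\<close>)
  then show ?case
    by (simp add: run_to_Suc Suc integral_bern_component[OF assms])
qed

lemma integral_block_right:
  assumes "0 \<le> p" "p \<le> 1"
  shows "(\<integral>r. block_right r n \<partial>bern p) = p ^ n * (1 - p)"
proof -
  have "(\<integral>r. block_right r n \<partial>bern p) = (\<integral>r. run_to r n \<partial>bern p) - (\<integral>r. run_to r (Suc n) \<partial>bern p)"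
    unfolding block_right_eq
    using run_to_01 by (intro Bochner_Integration.integral_diff integrable_bern[where C = 1]) auto
  then show ?thesis
    using assms by (simp add: integral_run_to algebra_simps)
qed

text \<open>The partial sums telescope and leave the integral of \<open>run_to r N * g r\<close>,
  which is at most \<open>C * p ^ N\<close> in absolute value. The almost sure existence of a
  two-step site to the right enters only through this bound.\<close>

lemma sums_block_right:
  assumes p: "0 \<le> p" "p < 1"
    and g: "g \<in> borel_measurable (bern p)" "\<And>r. \<bar>g r\<bar> \<le> C"
  shows "(\<lambda>n. \<integral>r. block_right r n * g r \<partial>bern p) sums (\<integral>r. g r \<partial>bern p)"
proof -
  note [measurable] = g(1)
  have C: "0 \<le> C" using g(2)[of undefined] by linarith
  have ir: "integrable (bern p) (\<lambda>r. run_to r N * g r)" for N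
  proof (rule integrable_bern[where C = C])
    show "\<bar>run_to r N * g r\<bar> \<le> C" for r
      using run_to_01[of r N] g(2)[of r] C mult_mono[of "run_to r N" 1 "\<bar>g r\<bar>" C] by (simp add: abs_mult)
  qed measurable
  have part: "(\<Sum>n<N. \<integral>r. block_right r n * g r \<partial>bern p)
      = (\<integral>r. g r \<partial>bern p) - (\<integral>r. run_to r N * g r \<partial>bern p)" for N
  proof (induction N)
    case (Suc N)
    have "(\<integral>r. block_right r N * g r \<partial>bern p) =
      (\<integral>r. run_to r N * g r \<partial>bern p) - (\<integral>r. run_to r (Suc N) * g r \<partial>bern p)"
      unfolding block_right_eq left_diff_distrib by (rule Bochner_Integration.integral_diff[OF ir ir])
    then show ?case
      using Suc by simp
  qed simp
  have bound: "\<bar>\<integral>r. run_to r N * g r \<partial>bern p\<bar> \<le> C * p ^ N" for N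
  proof -
    have "\<bar>\<integral>r. run_to r N * g r \<partial>bern p\<bar> \<le> (\<integral>r. \<bar>run_to r N * g r\<bar> \<partial>bern p)"
      by (rule integral_abs_bound)
    also have "\<dots> \<le> (\<integral>r. C * run_to r N \<partial>bern p)"
    proof (rule integral_mono)
      show "integrable (bern p) (\<lambda>r. C * run_to r N)"
        using run_to_01 C by (intro integrable_mult_right integrable_bern[where C = 1]) auto
      show "\<bar>run_to r N * g r\<bar> \<le> C * run_to r N" for r
        using run_to_01(1)[of r N] g(2)[of r] mult_left_mono[of "\<bar>g r\<bar>" C "run_to r N"]
        by (simp add: abs_mult mult.commute)
    qed (use ir in simp)
    finally show ?thesis
      using p by (simp add: integral_run_to)
  qed
  have "(\<lambda>N. \<integral>r. run_to r N * g r \<partial>bern p) \<longlonglongrightarrow> 0"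
  proof (rule Lim_null_comparison)
    show "\<forall>\<^sub>F N in sequentially. norm (\<integral>r. run_to r N * g r \<partial>bern p) \<le> C * p ^ N"
      using bound by simp
    show "(\<lambda>N. C * p ^ N) \<longlonglongrightarrow> 0"
      using p by (intro tendsto_mult_right_zero LIMSEQ_realpow_zero) auto
  qed
  from tendsto_diff[OF tendsto_const[of "\<integral>r. g r \<partial>bern p"] this] show ?thesis
    unfolding sums_def part by simp
qed

text \<open>Reflection of the row, applied to \<open>g\<close> as well, reduces the nearest two-step
  site on the left to the one on the right.\<close>

lemma sums_block_left:
  assumes p: "0 \<le> p" "p < 1"
    and g: "g \<in> borel_measurable (bern p)" "\<And>r. \<bar>g r\<bar> \<le> C"
  shows "(\<lambda>n. \<integral>r. block_right (\<lambda>i. r (- i)) n * g r \<partial>bern p) sums (\<integral>r. g r \<partial>bern p)"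
proof -
  have [measurable]: "(\<lambda>r. g (\<lambda>i. r (- i))) \<in> borel_measurable (bern p)"
    by (rule measurable_compose[OF measurable_bern_reindex g(1)])
  have inj: "inj (uminus :: int \<Rightarrow> int)" by simp
  have 1: "(\<integral>r. block_right r n * g (\<lambda>i. r (- i)) \<partial>bern p) =
      (\<integral>r. block_right (\<lambda>i. r (- i)) n * g r \<partial>bern p)" for n
    using integral_bern_reindex[OF inj, where p = p and g = "\<lambda>r. block_right r n * g (\<lambda>i. r (- i))"]
    by simp
  have 2: "(\<integral>r. g (\<lambda>i. r (- i)) \<partial>bern p) = (\<integral>r. g r \<partial>bern p)"
    by (rule integral_bern_reindex[OF inj g(1)])
  show ?thesis
    using sums_block_right[OF p, of "\<lambda>r. g (\<lambda>i. r (- i))" C] g(2) unfolding 1 2 by simp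
qed

section \<open>Linear equations for the averages at and beside two-step sites\<close>

definition kappa :: "real \<Rightarrow> real" where
  "kappa p = (\<integral>r. of_bool (\<not> r 0) * row_excess r 0 \<partial>bern p)"

definition lambda :: "real \<Rightarrow> real" where
  "lambda p = (\<integral>r. of_bool (\<not> r 0) * row_excess r 1 \<partial>bern p)"

text \<open>When \<open>0\<close> and \<open>n + 1\<close> are consecutive two-step sites,
  \<open>block_solution\<close> makes both values affine in \<open>row_excess r 0\<close>. At a
  two-step origin that value is a function of the sites \<open>i \<le> 0\<close>, while
  \<open>block_right\<close> looks at the sites \<open>i \<ge> 1\<close>, so the expectations
  factor.\<close>

lemma block_values:
  assumes p: "0 \<le> p" "p \<le> 1"
  shows "(\<integral>r. block_right r n * (of_bool (\<not> r 0) * row_excess r 1) \<partial>bern p)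
      = p ^ n * (1 - p) * (kappa p * (even_fib (Suc n) - even_fib n) - (1 - p)) / block_den n"
    and "(\<integral>r. block_right r n * (of_bool (\<not> r 0) * row_excess r (int n + 1)) \<partial>bern p)
      = p ^ n * (1 - p) * (kappa p - (1 - p) * even_fib (Suc n)) / block_den n"
proof -
  have bd: "\<bar>of_bool b * block_right r n\<bar> \<le> 1" for b r
    using abs_block_right[of r n] by simp
  have bd3: "\<bar>of_bool b * row_excess r 0\<bar> \<le> 3" for b r
    using abs_row_excess[of r 0] by simp
  \<comment> \<open>The factor \<open>of_bool (\<not> r 0)\<close> removes the influence of the
    sites on the right: by shielding if it is 1, trivially if it is 0.\<close>
  have dep: "depends_on {..0} (\<lambda>r. of_bool (\<not> r 0) * row_excess r 0)"
  proof (rule depends_onI)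
    fix r r' :: "int \<Rightarrow> bool"
    assume *: "\<And>i. i \<in> {..0} \<Longrightarrow> r i = r' i"
    then show "of_bool (\<not> r 0) * row_excess r 0 = of_bool (\<not> r' 0) * row_excess r' 0"
      using row_time_cong_left[of 0 r r' 0] by (cases "r 0") (auto simp: row_excess_def)
  qed
  have i1: "(\<integral>r. (of_bool (\<not> r 0) * row_excess r 0) * block_right r n \<partial>bern p) = kappa p * (p ^ n * (1 - p))"
    unfolding kappa_def integral_block_right[OF p, of n, symmetric]
    by (rule integral_bern_mult[where S = "{..0}" and S' = "{1..}" and C = 3 and D = 1])
      (use abs_block_right bd3 dep depends_on_block_right in auto)
  have i2: "(\<integral>r. of_bool (\<not> r 0) * block_right r n \<partial>bern p) = (1 - p) * (p ^ n * (1 - p))"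
    unfolding integral_block_right[OF p, of n, symmetric]
    by (subst integral_bern_component_not[OF p, of 0, symmetric], rule integral_bern_mult[where S = "{..0}" and S' = "{1..}" and C = 1 and D = 1])
      (use abs_block_right depends_on_block_right in \<open>auto intro!: depends_onI\<close>)
  have int1: "integrable (bern p) (\<lambda>r. c * ((of_bool (\<not> r 0) * row_excess r 0) * block_right r n))" for c
  proof (intro integrable_mult_right integrable_bern[where C = 3])
    show "\<bar>of_bool (\<not> r 0) * row_excess r 0 * block_right r n\<bar> \<le> 3" for r
      using mult_mono[OF bd3[of "\<not> r 0" r] abs_block_right[of r n]] by (simp add: abs_mult)
  qed measurable
  have int2: "integrable (bern p) (\<lambda>r. c * (of_bool (\<not> r 0) * block_right r n))" for c
    using bd by (intro integrable_mult_right integrable_bern[where C = 1]) auto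
  define B where "B r \<longleftrightarrow> \<not> r 0 \<and> (\<forall>i. 1 \<le> i \<and> i \<le> int n \<longrightarrow> r i) \<and> \<not> r (int n + 1)" for r
  have ind: "of_bool (\<not> r 0) * block_right r n = of_bool (B r)" for r
    by (auto simp: block_right_def run_to_eq B_def)
  have sol: "row_excess r 1 = (row_excess r 0 * (even_fib (Suc n) - even_fib n) - 1) / block_den n"
    "row_excess r (int n + 1) = (row_excess r 0 - even_fib (Suc n)) / block_den n" if "B r" for r
    using block_solution[of n "row_excess r"] that row_excess_three[of r] row_excess_two[of r "int n + 1"]
    by (simp_all add: B_def)
  have p1: "block_right r n * (of_bool (\<not> r 0) * row_excess r 1) =
     ((even_fib (Suc n) - even_fib n) / block_den n) * ((of_bool (\<not> r 0) * row_excess r 0) * block_right r n)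
     - (1 / block_den n) * (of_bool (\<not> r 0) * block_right r n)" for r
  proof -
    have "block_right r n * (of_bool (\<not> r 0) * row_excess r 1) = of_bool (B r) * row_excess r 1"
      by (simp add: ind[symmetric])
    also have "\<dots> = ((even_fib (Suc n) - even_fib n) / block_den n) * (of_bool (B r) * row_excess r 0)
      - (1 / block_den n) * of_bool (B r)"
      using sol(1)[of r] by (cases "B r") (simp_all add: diff_divide_distrib add_divide_distrib algebra_simps)
    finally show ?thesis
      by (simp add: ind[symmetric] mult_ac)
  qed
  have p2: "block_right r n * (of_bool (\<not> r 0) * row_excess r (int n + 1)) =
     (1 / block_den n) * ((of_bool (\<not> r 0) * row_excess r 0) * block_right r n)
     - (even_fib (Suc n) / block_den n) * (of_bool (\<not> r 0) * block_right r n)" for r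
  proof -
    have "block_right r n * (of_bool (\<not> r 0) * row_excess r (int n + 1)) = of_bool (B r) * row_excess r (int n + 1)"
      by (simp add: ind[symmetric])
    also have "\<dots> = (1 / block_den n) * (of_bool (B r) * row_excess r 0)
      - (even_fib (Suc n) / block_den n) * of_bool (B r)"
      using sol(2)[of r] by (cases "B r") (simp_all add: diff_divide_distrib mult.commute)
    finally show ?thesis
      by (simp add: ind[symmetric] mult_ac)
  qed
  show "(\<integral>r. block_right r n * (of_bool (\<not> r 0) * row_excess r 1) \<partial>bern p)
      = p ^ n * (1 - p) * (kappa p * (even_fib (Suc n) - even_fib n) - (1 - p)) / block_den n"
    unfolding p1 Bochner_Integration.integral_diff[OF int1 int2] Bochner_Integration.integral_mult_right_zero i1 i2
    by (simp add: algebra_simps diff_divide_distrib add_divide_distrib)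
  show "(\<integral>r. block_right r n * (of_bool (\<not> r 0) * row_excess r (int n + 1)) \<partial>bern p)
      = p ^ n * (1 - p) * (kappa p - (1 - p) * even_fib (Suc n)) / block_den n"
    unfolding p2 Bochner_Integration.integral_diff[OF int1 int2] Bochner_Integration.integral_mult_right_zero i1 i2
    by (simp add: algebra_simps diff_divide_distrib add_divide_distrib)
qed

lemma lambda_sums:
  assumes p: "0 \<le> p" "p < 1"
  shows "(\<lambda>n. p ^ n * (1 - p) * (kappa p * (even_fib (Suc n) - even_fib n) - (1 - p)) / block_den n) sums lambda p"
proof -
  have "\<bar>of_bool (\<not> r 0) * row_excess r 1\<bar> \<le> 3" for r
    using abs_row_excess[of r 1] by simp
  then show ?thesis
    using sums_block_right[OF p, of "\<lambda>r. of_bool (\<not> r 0) * row_excess r 1" 3] p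
    by (simp add: block_values lambda_def)
qed

text \<open>The same configuration seen from its two ends: a two-step site at \<open>n + 1\<close>
  whose preceding two-step site is \<open>0\<close>.\<close>

lemma block_left_shift:
  "block_right (\<lambda>i. r (- i + (int n + 1))) n * of_bool (\<not> r (int n + 1)) = block_right r n * of_bool (\<not> r 0)"
proof -
  have "(\<forall>i. 1 \<le> i \<and> i \<le> int n \<longrightarrow> r (- i + (int n + 1))) \<longleftrightarrow> (\<forall>i. 1 \<le> i \<and> i \<le> int n \<longrightarrow> r i)"
  proof (intro iffI allI impI)
    fix i assume *: "\<forall>i. 1 \<le> i \<and> i \<le> int n \<longrightarrow> r (- i + (int n + 1))" "1 \<le> i \<and> i \<le> int n"
    show "r i"
      using *(1)[rule_format, of "int n + 1 - i"] *(2) by simp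
  qed simp
  then show ?thesis
    by (simp add: block_right_def run_to_eq)
qed

text \<open>The self-consistency equation. The decomposition is now by the nearest two-step site to
  the left of the origin; a shift by \<open>n + 1\<close> moves that site to the origin, so the
  value in question becomes \<open>row_excess r (int n + 1)\<close>, and \<open>block_values\<close>
  returns it in terms of \<open>kappa p\<close> itself.\<close>

lemma kappa_sums:
  assumes p: "0 \<le> p" "p < 1"
  shows "(\<lambda>n. p ^ n * (1 - p) * (kappa p - (1 - p) * even_fib (Suc n)) / block_den n) sums kappa p"
proof -
  have "(\<integral>r. block_right (\<lambda>i. r (- i)) n * (of_bool (\<not> r 0) * row_excess r 0) \<partial>bern p)
      = p ^ n * (1 - p) * (kappa p - (1 - p) * even_fib (Suc n)) / block_den n" for n
  proof -
    have [measurable]: "(\<lambda>r. block_right (\<lambda>i. r (- i)) n) \<in> borel_measurable (bern p)"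
      by (rule measurable_compose[OF measurable_bern_reindex measurable_block_right])
    have "(\<integral>r. block_right (\<lambda>i. r (- i)) n * (of_bool (\<not> r 0) * row_excess r 0) \<partial>bern p) =
       (\<integral>r. block_right (\<lambda>i. r (- i + (int n + 1))) n * (of_bool (\<not> r (0 + (int n + 1))) *
          row_excess (\<lambda>i. r (i + (int n + 1))) 0) \<partial>bern p)"
      by (rule integral_bern_reindex[symmetric, where f = "\<lambda>i. i + (int n + 1)"
            and g = "\<lambda>r. block_right (\<lambda>i. r (- i)) n * (of_bool (\<not> r 0) * row_excess r 0)"])
        (auto simp: inj_def)
    also have "\<dots> = (\<integral>r. block_right r n * (of_bool (\<not> r 0) * row_excess r (int n + 1)) \<partial>bern p)"
      unfolding row_excess_shift mult.assoc[symmetric] add_0 block_left_shift by simp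
    finally show ?thesis
      using p by (simp add: block_values)
  qed
  moreover have "\<bar>of_bool (\<not> r 0) * row_excess r 0\<bar> \<le> 3" for r
    using abs_row_excess[of r 0] by simp
  ultimately show ?thesis
    using sums_block_left[OF p, of "\<lambda>r. of_bool (\<not> r 0) * row_excess r 0" 3] by (simp add: kappa_def)
qed

text \<open>The relation \<open>3 w(0) = w(1) + w(-1)\<close> on three-step sites is averaged; by stationarity the
  neighbours of \<open>0\<close> contribute all sites except those next to a two-step site.\<close>

lemma integral_row_time:
  assumes p: "0 \<le> p" "p \<le> 1"
  shows "(\<integral>r. row_time r 0 \<partial>bern p) = 2 + p + kappa p - lambda p"
proof -
  interpret prob_space "bern p :: (int \<Rightarrow> bool) measure" by (rule prob_space_bern)
  have int: "integrable (bern p) (\<lambda>r. row_excess r i)" for i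
    by (rule integrable_bern[where C = 3]) (use abs_row_excess in auto)
  have int2: "integrable (bern p) (\<lambda>r. of_bool (\<not> r j) * row_excess r i)" for i j
    by (rule integrable_bern[where C = 3]) (use abs_row_excess in auto)
  have shift: "(\<integral>r. row_excess r i \<partial>bern p) = (\<integral>r. row_excess r 0 \<partial>bern p)" for i
    using integral_bern_reindex[where f = "\<lambda>j. j + i" and p = p and g = "\<lambda>r. row_excess r 0"]
    by (simp add: row_excess_shift)
  let ?w = "\<integral>r. row_excess r 0 \<partial>bern p"
  have "3 * row_excess r 0 - 3 * (of_bool (\<not> r 0) * row_excess r 0) =
      (row_excess r 1 - of_bool (\<not> r 0) * row_excess r 1) + (row_excess r (-1) - of_bool (\<not> r 0) * row_excess r (-1))" for r
    using row_excess_three[of r 0] by (cases "r 0") auto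
  \<comment> \<open>At a two-step site its own equation gives the left neighbour, so beside
    \<open>kappa p\<close> only the right neighbour, \<open>lambda p\<close>, remains.\<close>
  moreover have "of_bool (\<not> r 0) * row_excess r (-1) = 2 * (of_bool (\<not> r 0) * row_excess r 0) + of_bool (\<not> r 0)" for r
    using row_excess_two[of r 0] by (cases "r 0") auto
  ultimately have "3 * row_excess r 0 = row_excess r 1 + row_excess r (-1) - of_bool (\<not> r 0) * row_excess r 1
      + of_bool (\<not> r 0) * row_excess r 0 - of_bool (\<not> r 0)" for r
    by (smt (verit))
  then have "(\<integral>r. 3 * row_excess r 0 \<partial>bern p) = (\<integral>r. row_excess r 1 + row_excess r (-1) - of_bool (\<not> r 0) * row_excess r 1
      + of_bool (\<not> r 0) * row_excess r 0 - of_bool (\<not> r 0) \<partial>bern p)"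
    by presburger
  also have "\<dots> = (\<integral>r. row_excess r 1 \<partial>bern p) + (\<integral>r. row_excess r (-1) \<partial>bern p) - lambda p + kappa p
      - (\<integral>r. of_bool (\<not> r 0) \<partial>(bern p :: (int \<Rightarrow> bool) measure))"
    unfolding lambda_def kappa_def
    using int int2 integrable_bern[where C = 1 and p = p and f = "\<lambda>r. of_bool (\<not> r (0::int))"] by simp
  finally have "?w = kappa p - lambda p - (1 - p)"
    unfolding shift[of 1] shift[of "-1"] integral_bern_component_not[OF p] by simp
  moreover have "(\<integral>r. row_time r 0 \<partial>bern p) = (\<integral>r. row_excess r 0 + 3 \<partial>bern p)"
    by (simp add: row_excess_def)
  moreover have "(\<integral>r. row_excess r 0 + 3 \<partial>bern p) = ?w + 3"
    using int by simp
  ultimately show ?thesis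
    by simp
qed

section \<open>The closed form of the mean\<close>

lemma gam_square: "gam ^ 2 = 3 * gam - 1"
  by (simp add: gam_def power2_eq_square field_simps)

lemma gam_gt_2: "2 < gam"
proof -
  have "1 < sqrt 5" by (simp add: real_less_rsqrt)
  then show ?thesis by (simp add: gam_def)
qed

lemma gam_power_even_fib: "gam ^ n = even_fib (Suc n) - (3 - gam) * even_fib n"
proof (induction n)
  case (Suc n)
  have "gam ^ Suc n = gam * even_fib (Suc n) - (3 * gam - gam ^ 2) * even_fib n"
    unfolding power_Suc Suc by (simp add: algebra_simps power2_eq_square)
  then show ?case
    by (simp add: gam_square algebra_simps)
qed simp

text \<open>The factor in parentheses is \<open>(3 - gam) ^ n\<close>, the power of the conjugate
  root \<open>3 - gam = 1 / gam\<close>; it is \<open>gam_power_even_fib\<close> with the two roots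
  exchanged.\<close>

lemma gam_power_inverse_even_fib: "gam ^ n * (even_fib (Suc n) - gam * even_fib n) = 1"
proof -
  have "(even_fib (Suc n) - (3 - gam) * even_fib n) * (even_fib (Suc n) - gam * even_fib n) =
    even_fib (Suc n) ^ 2 + (3 * gam - gam ^ 2) * even_fib n ^ 2 - 3 * even_fib n * even_fib (Suc n)"
    by (simp add: algebra_simps power2_eq_square)
  then show ?thesis
    unfolding gam_power_even_fib[of n] gam_square using even_fib_invariant[of n] by simp
qed

text \<open>This ties \<open>Theta\<close> to the blocks. Evaluating \<open>Theta\<close> at
  \<open>p\<close>, \<open>p * gam\<close> and \<open>p * gam^2\<close> sums
  \<open>p ^ n / block_den n\<close> with the weights \<open>1 / gam ^ n\<close>, 1 and
  \<open>gam ^ n\<close>, up to the constant \<open>- 1 / (gam^2 - 1)\<close>.\<close>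

lemma Theta_denominator:
  "gam ^ (2 * n + 1) * (1 - 2 * gam) - gam + 2 = - ((gam ^ 2 - 1) * gam ^ n * block_den n)"
proof -
  define x where "x = gam ^ n"
  have x2: "gam ^ (2 * n + 1) = x ^ 2 * gam"
    by (simp add: x_def power_mult[symmetric] mult.commute)
  have 1: "x = even_fib (Suc n) - (3 - gam) * even_fib n"
    unfolding x_def by (rule gam_power_even_fib)
  have 2: "x * (even_fib (Suc n) - gam * even_fib n) = 1"
    unfolding x_def by (rule gam_power_inverse_even_fib)
  have "x ^ 2 * gam * (1 - 2 * gam) - gam + 2 = - ((gam ^ 2 - 1) * x * (2 * even_fib (Suc n) - even_fib n))"
    using 1 2 gam_square by algebra
  then show ?thesis
    by (simp only: x2 x_def[symmetric] block_den_def)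
qed

text \<open>The weights \<open>gam ^ n\<close> and \<open>1 / gam ^ n\<close> are combinations of
  \<open>even_fib (Suc n)\<close> and \<open>even_fib n\<close>, so the three values of
  \<open>Theta\<close> translate into the series in which \<open>kappa\<close> and
  \<open>lambda\<close> are naturally expressed. All numerators are at most
  \<open>block_den n\<close>, so \<open>p ^ n\<close> dominates the terms.\<close>

lemma Theta_sums:
  assumes p: "0 \<le> p" "p < 1"
  defines "a \<equiv> \<Sum>n. p ^ n / block_den n"
    and "b \<equiv> \<Sum>n. p ^ n * even_fib (Suc n) / block_den n"
    and "c \<equiv> \<Sum>n. p ^ n * even_fib n / block_den n"
  shows "(\<lambda>n. p ^ n / block_den n) sums a"
    and "(\<lambda>n. p ^ n * even_fib (Suc n) / block_den n) sums b"
    and "(\<lambda>n. p ^ n * even_fib n / block_den n) sums c"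
    and "Theta (p * gam) = - a / (gam ^ 2 - 1)"
    and "Theta p = - (b - gam * c) / (gam ^ 2 - 1)"
    and "Theta (p * gam ^ 2) = - (b - (3 - gam) * c) / (gam ^ 2 - 1)"
proof -
  have le: "norm (p ^ n * x / block_den n) \<le> p ^ n" if "0 \<le> x" "x \<le> block_den n" for n x
  proof -
    have "x / block_den n \<le> 1" "0 \<le> x / block_den n"
      using block_den_ge(1)[of n] that by simp_all
    then show ?thesis
      using p mult_left_mono[of "x / block_den n" 1 "p ^ n"] that by simp
  qed
  have summ: "summable (\<lambda>n. p ^ n * x n / block_den n)" if "\<And>n. 0 \<le> x n" "\<And>n. x n \<le> block_den n" for x
    by (rule summable_comparison_test'[OF summable_geometric[of p], of 0]) (use p in simp, rule le[OF that])
  have "1 \<le> block_den n" for n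
    using block_den_ge(1)[of n] by simp
  then show A: "(\<lambda>n. p ^ n / block_den n) sums a"
    using summ[of "\<lambda>_. 1"] unfolding a_def by (simp add: summable_sums)
  show B: "(\<lambda>n. p ^ n * even_fib (Suc n) / block_den n) sums b"
    unfolding b_def using even_fib_growth block_den_ge by (intro summable_sums summ) auto
  show C: "(\<lambda>n. p ^ n * even_fib n / block_den n) sums c"
    unfolding c_def using even_fib_growth block_den_ge by (intro summable_sums summ) auto
  have g: "gam ^ 2 - 1 > 0" "gam \<noteq> 0" "\<And>n. gam ^ n \<noteq> 0"
    using gam_gt_2 by (simp_all add: gam_square)
  have d: "block_den n \<noteq> 0" for n
    using block_den_ge(1)[of n] by simp
  have "(p * gam) ^ n / (gam ^ (2 * n + 1) * (1 - 2 * gam) - gam + 2) = - (p ^ n / block_den n) / (gam ^ 2 - 1)" for n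
    unfolding Theta_denominator using g d by (simp add: power_mult_distrib)
  then show "Theta (p * gam) = - a / (gam ^ 2 - 1)"
    unfolding Theta_def using sums_divide[OF sums_minus[OF A], of "gam ^ 2 - 1"] by (simp add: sums_iff)
  have "p ^ n / (gam ^ (2 * n + 1) * (1 - 2 * gam) - gam + 2) =
      - (p ^ n * even_fib (Suc n) / block_den n - gam * (p ^ n * even_fib n / block_den n)) / (gam ^ 2 - 1)" for n
  proof -
    have inv: "1 / gam ^ n = even_fib (Suc n) - gam * even_fib n"
      using gam_power_inverse_even_fib[of n] g by (simp add: field_simps)
    have "p ^ n * (1 / gam ^ n) / block_den n =
      p ^ n * even_fib (Suc n) / block_den n - gam * (p ^ n * even_fib n / block_den n)"
      unfolding inv by (simp add: algebra_simps diff_divide_distrib)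
    moreover have "p ^ n / - ((gam ^ 2 - 1) * gam ^ n * block_den n) =
      - (p ^ n * (1 / gam ^ n) / block_den n) / (gam ^ 2 - 1)"
      by (simp add: mult_ac)
    ultimately show ?thesis
      unfolding Theta_denominator by simp
  qed
  then show "Theta p = - (b - gam * c) / (gam ^ 2 - 1)"
    unfolding Theta_def
    using sums_divide[OF sums_minus[OF sums_diff[OF B sums_mult[OF C, of gam]]], of "gam ^ 2 - 1"]
    by (simp add: sums_iff)
  have "(p * gam ^ 2) ^ n / (gam ^ (2 * n + 1) * (1 - 2 * gam) - gam + 2) =
      - (p ^ n * even_fib (Suc n) / block_den n - (3 - gam) * (p ^ n * even_fib n / block_den n)) / (gam ^ 2 - 1)" for n
  proof -
    have eq: "p ^ n * gam ^ n / block_den n =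
      p ^ n * even_fib (Suc n) / block_den n - (3 - gam) * (p ^ n * even_fib n / block_den n)"
      unfolding gam_power_even_fib by (simp add: algebra_simps diff_divide_distrib add_divide_distrib)
    have "(gam ^ 2) ^ n = gam ^ n * gam ^ n"
      by (simp add: power2_eq_square power_mult_distrib)
    then have "(p * gam ^ 2) ^ n / - ((gam ^ 2 - 1) * gam ^ n * block_den n) =
      - (p ^ n * gam ^ n / block_den n) / (gam ^ 2 - 1)"
      using g by (simp add: power_mult_distrib)
    then show ?thesis
      unfolding Theta_denominator eq .
  qed
  then show "Theta (p * gam ^ 2) = - (b - (3 - gam) * c) / (gam ^ 2 - 1)"
    unfolding Theta_def
    using sums_divide[OF sums_minus[OF sums_diff[OF B sums_mult[OF C, of "3 - gam"]]], of "gam ^ 2 - 1"]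
    by (simp add: sums_iff)
qed

lemma integral_row_time_closed_form:
  assumes p: "0 \<le> p" "p < 1"
    and S0: "S0 = 3 + (1 - p)^2 / (gam - 1) *
        ((gam^3 + 6 * gam^2 - 3 * gam) * Theta (p * gam^2)
         + (3 * gam^3 - 7 * gam^2 - 7 * gam + 3) * Theta (p * gam)
         - (3 * gam^2 - 6 * gam - 1) * Theta p)"
    and S1: "S1 = 3 + (1 - p) *
        (gam^2 * Theta (p * gam^2) + 3 * (gam^2 - 1) * Theta (p * gam) - Theta p)"
    and A0: "A0 = (1 - p)^2 / (gam - 1) *
        (gam * (1 - 2 * gam) * Theta (p * gam^2)
         - (gam^3 - 2 * gam^2 - 2 * gam + 1) * Theta (p * gam)
         + gam * (gam - 2) * Theta p)"
  shows "(\<integral>r. row_time r 0 \<partial>bern p) = S0 + S1 * A0 / (1 - (1 - p) * (1 - gam^2) * Theta (p * gam))"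
proof -
  define a where "a = (\<Sum>n. p ^ n / block_den n)"
  define b where "b = (\<Sum>n. p ^ n * even_fib (Suc n) / block_den n)"
  define c where "c = (\<Sum>n. p ^ n * even_fib n / block_den n)"
  define q where "q = 1 - p"
  have q: "q \<noteq> 0" using p by (simp add: q_def)
  note sums = Theta_sums(1-3)[OF p, folded a_def b_def c_def]
  note Th = Theta_sums(4-6)[OF p, folded a_def b_def c_def]
  have g: "gam - 1 \<noteq> 0" "gam ^ 2 - 1 \<noteq> 0"
    using gam_gt_2 by (simp_all add: gam_square)
  \<comment> \<open>By the definition of \<open>block_den\<close> this combination of series is
    geometric. The relation is needed at the end to match the stated expression with
    \<open>2 + p + kappa p - lambda p\<close>.\<close>
  have bc: "(2 * b - c) * q = 1"
  proof -
    have d: "block_den n \<noteq> 0" for n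
      using block_den_ge(1)[of n] by simp
    have "2 * (p ^ n * even_fib (Suc n) / block_den n) - p ^ n * even_fib n / block_den n = p ^ n" for n
    proof -
      have "2 * (p ^ n * even_fib (Suc n) / block_den n) - p ^ n * even_fib n / block_den n =
        p ^ n * (2 * even_fib (Suc n) - even_fib n) / block_den n"
        by (simp add: diff_divide_distrib algebra_simps)
      then show ?thesis using d by (simp add: block_den_def[symmetric])
    qed
    then have "(\<lambda>n. p ^ n) sums (2 * b - c)"
      using sums_diff[OF sums_mult[OF sums(2), of 2] sums(3)] by simp
    then have "2 * b - c = 1 / q"
      using p geometric_sums[of p] sums_unique2 unfolding q_def by fastforce
    then show ?thesis using q by simp
  qed
  \<comment> \<open>From \<open>block_den n \<ge> 2\<close>; it keeps the denominator
    \<open>1 - q * a\<close> away from 0.\<close>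
  have a: "q * a \<le> 1 / 2"
  proof -
    have "a \<le> (\<Sum>n. p ^ n / 2)"
      unfolding a_def using p block_den_ge(1)
      by (intro suminf_le sums_summable[OF sums(1)] summable_divide summable_geometric divide_left_mono)
        (auto intro!: mult_pos_pos order.strict_trans2[OF _ block_den_ge(1)])
    also have "\<dots> = 1 / q / 2"
      using p by (simp add: suminf_divide suminf_geometric q_def)
    finally show ?thesis
      using p q by (simp add: q_def field_simps)
  qed
  have kappa: "kappa p = q * kappa p * a - q ^ 2 * b"
  proof -
    have "(\<lambda>n. q * kappa p * (p ^ n / block_den n) - q ^ 2 * (p ^ n * even_fib (Suc n) / block_den n)) sums (q * kappa p * a - q ^ 2 * b)"
      by (intro sums_diff sums_mult sums)
    moreover have "q * kappa p * (p ^ n / block_den n) - q ^ 2 * (p ^ n * even_fib (Suc n) / block_den n)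
      = p ^ n * (1 - p) * (kappa p - (1 - p) * even_fib (Suc n)) / block_den n" for n
      unfolding q_def[symmetric] by (simp add: algebra_simps diff_divide_distrib add_divide_distrib power2_eq_square)
    ultimately show ?thesis
      using kappa_sums[OF p] sums_unique2 by simp blast
  qed
  have lambda: "lambda p = q * kappa p * (b - c) - q ^ 2 * a"
  proof -
    have "(\<lambda>n. q * kappa p * (p ^ n * even_fib (Suc n) / block_den n - p ^ n * even_fib n / block_den n)
        - q ^ 2 * (p ^ n / block_den n)) sums (q * kappa p * (b - c) - q ^ 2 * a)"
      by (intro sums_diff sums_mult sums)
    moreover have "q * kappa p * (p ^ n * even_fib (Suc n) / block_den n - p ^ n * even_fib n / block_den n)
        - q ^ 2 * (p ^ n / block_den n)
      = p ^ n * (1 - p) * (kappa p * (even_fib (Suc n) - even_fib n) - (1 - p)) / block_den n" for n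
      unfolding q_def[symmetric] by (simp add: algebra_simps diff_divide_distrib add_divide_distrib power2_eq_square)
    ultimately show ?thesis
      using lambda_sums[OF p] sums_unique2 by simp blast
  qed
  have den: "1 - (1 - p) * (1 - gam^2) * Theta (p * gam) = 1 - q * a"
    unfolding Th q_def[symmetric] using g by (simp add: field_simps)
  \<comment> \<open>Once the denominators are cleared, this is a polynomial identity modulo
    \<open>gam^2 = 3 * gam - 1\<close> with \<open>a\<close>, \<open>b\<close>, \<open>c\<close> as
    free variables; the same device handles \<open>S1\<close> and \<open>S0\<close>.\<close>
  have A0': "A0 = q ^ 2 * b"
  proof -
    have "A0 * ((gam - 1) * (gam ^ 2 - 1)) = - (q ^ 2 *
        (gam * (1 - 2 * gam) * (b - (3 - gam) * c)
         - (gam^3 - 2 * gam^2 - 2 * gam + 1) * a + gam * (gam - 2) * (b - gam * c)))"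
      unfolding A0 Th q_def[symmetric] using g by (simp add: divide_simps) (simp add: algebra_simps)
    also have "\<dots> = q ^ 2 * b * ((gam - 1) * (gam ^ 2 - 1))"
      using gam_square by algebra
    finally show ?thesis using g by simp
  qed
  have S1': "S1 = 3 - q * (b + 3 * a)"
  proof -
    have "(S1 - 3) * (gam ^ 2 - 1) = - (q *
        (gam ^ 2 * (b - (3 - gam) * c) + 3 * (gam ^ 2 - 1) * a - (b - gam * c)))"
      unfolding S1 Th q_def[symmetric] using g by (simp add: divide_simps) (simp add: algebra_simps)
    also have "\<dots> = - (q * (b + 3 * a)) * (gam ^ 2 - 1)"
      using gam_square by algebra
    finally have "S1 - 3 = - (q * (b + 3 * a))"
      by (rule iffD1[OF mult_right_cancel[OF g(2)]])
    then show ?thesis by simp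
  qed
  have S0': "S0 = 3 + q ^ 2 * (a - 5 * b + c)"
  proof -
    have "(S0 - 3) * ((gam - 1) * (gam ^ 2 - 1)) = - (q ^ 2 *
        ((gam^3 + 6 * gam^2 - 3 * gam) * (b - (3 - gam) * c)
         + (3 * gam^3 - 7 * gam^2 - 7 * gam + 3) * a
         - (3 * gam^2 - 6 * gam - 1) * (b - gam * c)))"
      unfolding S0 Th q_def[symmetric] using g by (simp add: divide_simps) (simp add: algebra_simps)
    also have "\<dots> = q ^ 2 * (a - 5 * b + c) * ((gam - 1) * (gam ^ 2 - 1))"
      using gam_square by algebra
    finally show ?thesis using g by simp
  qed
  have "1 - q * a \<noteq> 0" using a by linarith
  \<comment> \<open>This is the affine equation for \<open>kappa p\<close> solved for its constant
    term, so the quotient of \<open>A0\<close> by the denominator is just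
    \<open>- kappa p\<close>.\<close>
  moreover have "A0 = - (kappa p) * (1 - q * a)"
    using kappa unfolding A0' by (simp add: algebra_simps)
  ultimately have frac: "S1 * A0 / (1 - q * a) = - (kappa p) * S1"
    by simp
  have pq: "p = 1 - q" by (simp add: q_def)
  show ?thesis
    unfolding den frac unfolding integral_row_time[OF p(1) less_imp_le[OF p(2)]] lambda S0' S1'
    using kappa bc pq by algebra
qed

section \<open>Marginals of the quenched walk\<close>

definition env :: "(site \<Rightarrow> bool) \<Rightarrow> site \<Rightarrow> site set" where
  "env t x = (if t x then {e1, - e1, - e2} else {- e1, - e2})"

definition step_prob :: "(site \<Rightarrow> bool) \<Rightarrow> site \<Rightarrow> site \<Rightarrow> real" where
  "step_prob t x e = pmf (pmf_of_set (env t x)) e"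

abbreviation steps :: "site set" where
  "steps \<equiv> {(1, 0), (- 1, 0), (0, - 1)}"

lemma step_prob_eq:
  "step_prob t x e = (if t x then of_bool (e \<in> steps) / 3 else of_bool (e \<in> {(- 1, 0), (0, - 1)}) / 2)"
  unfolding step_prob_def env_def by (subst pmf_of_set) (auto simp: zero_prod_def)

lemma step_prob_nonneg [simp]: "0 \<le> step_prob t x e"
  by (simp add: step_prob_def)

lemma step_prob_simps [simp]:
  "step_prob t x (1, 0) = of_bool (t x) / 3"
  "step_prob t x (- 1, 0) = (if t x then 1 / 3 else 1 / 2)"
  "step_prob t x (0, - 1) = (if t x then 1 / 3 else 1 / 2)"
  by (simp_all add: step_prob_eq)

lemma step_prob_eq_0: "e \<notin> steps \<Longrightarrow> step_prob t x e = 0"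
  by (auto simp: step_prob_eq)

lemma sum_step_prob: "(\<Sum>e\<in>steps. step_prob t x e) = 1"
  by simp

lemma measurable_step_prob [measurable]: "(\<lambda>t. step_prob t x e) \<in> borel_measurable (bern p)"
  unfolding step_prob_eq by measurable

text \<open>Contains every site reachable in \<open>n\<close> steps. Quenched means thus become
  finite sums, and the bound 0 on the second coordinate records that the walk never moves
  up.\<close>

definition walk_box :: "nat \<Rightarrow> site set" where
  "walk_box n = {- int n..int n} \<times> {- int n..0}"

lemma finite_walk_box [simp]: "finite (walk_box n)"
  by (simp add: walk_box_def)

lemma walk_box_step: "x \<in> walk_box n \<Longrightarrow> e \<in> steps \<Longrightarrow> x + e \<in> walk_box (Suc n)"
  by (cases x) (auto simp: walk_box_def)

text \<open>The quenched law of the position at time \<open>n\<close> as an explicit recursion, from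
  which measurability in the environment and locality can be read off;
  \<open>emeasure_quenched_occupation\<close> identifies it.\<close>

fun occupation :: "(site \<Rightarrow> bool) \<Rightarrow> nat \<Rightarrow> site \<Rightarrow> real" where
  "occupation t 0 x = of_bool (x = 0)"
| "occupation t (Suc n) x = (\<Sum>e\<in>steps. occupation t n (x - e) * step_prob t (x - e) e)"

definition walk_mean :: "(site \<Rightarrow> bool) \<Rightarrow> nat \<Rightarrow> (site \<Rightarrow> real) \<Rightarrow> real" where
  "walk_mean t n F = (\<Sum>x\<in>walk_box n. occupation t n x * F x)"

lemma occupation_nonneg [simp]: "0 \<le> occupation t n x"
  by (induction n arbitrary: x) (auto intro!: add_nonneg_nonneg)

lemma occupation_outside: "x \<notin> walk_box n \<Longrightarrow> occupation t n x = 0"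
proof (induction n arbitrary: x)
  case (Suc n)
  have *: "x - e \<notin> walk_box n" if "e \<in> steps" for e
    using walk_box_step[of "x - e" n e] that Suc.prems by auto
  show ?case
    unfolding occupation.simps
  proof (intro sum.neutral ballI)
    fix e assume "e \<in> steps"
    then show "occupation t n (x - e) * step_prob t (x - e) e = 0"
      by (simp only: Suc.IH[OF *] mult_zero_left)
  qed
qed (auto simp: walk_box_def zero_prod_def)

lemma measurable_occupation [measurable]: "(\<lambda>t. occupation t n x) \<in> borel_measurable (bern p)"
proof (induction n arbitrary: x)
  case (Suc n)
  note [measurable] = Suc
  show ?case
    unfolding occupation.simps by measurable
qed simp

text \<open>A path to \<open>x\<close> that never moves up has only seen rows at or above that of
  \<open>x\<close>. This makes the past independent of the row entered by a step down.\<close>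

lemma depends_on_occupation: "depends_on {z. snd x \<le> snd z} (\<lambda>t. occupation t n x)"
proof (rule depends_onI)
  fix t t' :: "site \<Rightarrow> bool"
  assume *: "\<And>z. z \<in> {z. snd x \<le> snd z} \<Longrightarrow> t z = t' z"
  have "occupation t n y = occupation t' n y" if "snd x \<le> snd y" for y
    using that
  proof (induction n arbitrary: y)
    case (Suc n)
    have "snd x \<le> snd (y - e)" if "e \<in> steps" for e
      using Suc.prems that by auto
    then show ?case
      unfolding occupation.simps using * Suc.IH by (intro sum.cong) (auto simp: step_prob_eq)
  qed simp
  then show "occupation t n x = occupation t' n x" by simp
qed

lemma walk_mean_0: "walk_mean t 0 F = F 0"
proof -
  have "walk_box 0 = {0}"
    by (auto simp: walk_box_def zero_prod_def)
  then show ?thesis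
    by (simp add: walk_mean_def)
qed

text \<open>Exchanging sums and shifting the summation variable turns the forward recursion of the
  law into the backward one, where a step is averaged against \<open>F\<close>.\<close>

lemma walk_mean_Suc:
  "walk_mean t (Suc n) F = walk_mean t n (\<lambda>x. \<Sum>e\<in>steps. step_prob t x e * F (x + e))"
proof -
  have "walk_mean t (Suc n) F =
      (\<Sum>e\<in>steps. \<Sum>x\<in>walk_box (Suc n). occupation t n (x - e) * step_prob t (x - e) e * F x)"
    unfolding walk_mean_def occupation.simps sum_distrib_right by (rule sum.swap)
  also have "\<dots> = (\<Sum>e\<in>steps. \<Sum>y\<in>walk_box n. occupation t n y * step_prob t y e * F (y + e))"
  proof (rule sum.cong[OF refl])
    fix e assume e: "e \<in> steps"
    have "(\<Sum>y\<in>walk_box n. occupation t n y * step_prob t y e * F (y + e)) =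
        (\<Sum>x\<in>(\<lambda>y. y + e) ` walk_box n. occupation t n (x - e) * step_prob t (x - e) e * F x)"
      by (subst sum.reindex) (auto simp: inj_on_def)
    also have "\<dots> = (\<Sum>x\<in>walk_box (Suc n). occupation t n (x - e) * step_prob t (x - e) e * F x)"
    proof (rule sum.mono_neutral_left)
      show "(\<lambda>y. y + e) ` walk_box n \<subseteq> walk_box (Suc n)"
        using walk_box_step[OF _ e] by auto
      show "\<forall>x\<in>walk_box (Suc n) - (\<lambda>y. y + e) ` walk_box n. occupation t n (x - e) * step_prob t (x - e) e * F x = 0"
      proof
        fix x assume x: "x \<in> walk_box (Suc n) - (\<lambda>y. y + e) ` walk_box n"
        then have "x - e \<notin> walk_box n"
          by (metis DiffD2 diff_add_cancel imageI)
        then show "occupation t n (x - e) * step_prob t (x - e) e * F x = 0"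
          by (simp add: occupation_outside)
      qed
    qed simp
    finally show "(\<Sum>x\<in>walk_box (Suc n). occupation t n (x - e) * step_prob t (x - e) e * F x) =
      (\<Sum>y\<in>walk_box n. occupation t n y * step_prob t y e * F (y + e))" by simp
  qed
  also have "\<dots> = walk_mean t n (\<lambda>x. \<Sum>e\<in>steps. step_prob t x e * F (x + e))"
    unfolding walk_mean_def sum_distrib_left by (subst sum.swap) (simp add: mult.assoc del: sum.insert)
  finally show ?thesis .
qed

lemma walk_mean_mono: "(\<And>x. x \<in> walk_box n \<Longrightarrow> F x \<le> G x) \<Longrightarrow> walk_mean t n F \<le> walk_mean t n G"
  unfolding walk_mean_def by (intro sum_mono mult_left_mono) auto

lemma walk_mean_cong: "(\<And>x. x \<in> walk_box n \<Longrightarrow> F x = G x) \<Longrightarrow> walk_mean t n F = walk_mean t n G"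
  unfolding walk_mean_def by (intro sum.cong) auto

lemma walk_mean_add: "walk_mean t n (\<lambda>x. F x + G x) = walk_mean t n F + walk_mean t n G"
  by (simp add: walk_mean_def algebra_simps sum.distrib)

lemma walk_mean_diff: "walk_mean t n (\<lambda>x. F x - G x) = walk_mean t n F - walk_mean t n G"
  by (simp add: walk_mean_def algebra_simps sum_subtractf)

lemma walk_mean_cmult: "walk_mean t n (\<lambda>x. c * F x) = c * walk_mean t n F"
  by (simp add: walk_mean_def sum_distrib_left algebra_simps)

lemma walk_mean_const: "walk_mean t n (\<lambda>_. c) = c"
proof (induction n)
  case (Suc n)
  then show ?case
    unfolding walk_mean_Suc sum_distrib_right[symmetric] sum_step_prob by simp
qed (simp add: walk_mean_0)

lemma walk_mean_nonneg: "(\<And>x. x \<in> walk_box n \<Longrightarrow> 0 \<le> F x) \<Longrightarrow> 0 \<le> walk_mean t n F"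
  unfolding walk_mean_def by (intro sum_nonneg mult_nonneg_nonneg) auto

lemma measurable_path_position [measurable]: "(\<lambda>X. X n) \<in> measurable (quenched \<omega>) (count_space UNIV)"
proof -
  have "(\<lambda>X. X n) \<in> measurable path_space (count_space UNIV)"
    by measurable
  then show ?thesis
    using measurable_cong_sets[OF sets_quenched refl] by blast
qed

lemma sets_path_event [measurable]: "{X. P (X n)} \<in> sets (quenched \<omega>)"
  using measurable_sets[OF measurable_path_position[of n \<omega>], of "{x. P x}"] by (simp add: vimage_def)

text \<open>The Markov property at a fixed time, from the cylinder weights: the event is a countable
  disjoint union over histories, and appending one step multiplies each weight by the same
  factor.\<close>

lemma emeasure_quenched_step:
  "emeasure (quenched (env t)) {X. X n = x \<and> X (Suc n) = y} =
    ennreal (step_prob t x (y - x)) * emeasure (quenched (env t)) {X. X n = x}"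
proof -
  let ?Q = "quenched (env t)"
  \<comment> \<open>Histories are extensional on \<open>{..n}\<close>, so each initial segment is
    counted once and there are only countably many.\<close>
  let ?H = "{h \<in> Pi\<^sub>E {..n} (\<lambda>_. UNIV :: site set). h n = x}"
  let ?A = "\<lambda>h. {X. \<forall>i\<le>n. X i = h i}"
  let ?B = "\<lambda>h. {X. \<forall>i\<le>Suc n. X i = (h(Suc n := y)) i}"
  have cyl: "{X. \<forall>i\<le>n. X i = h i} \<in> sets ?Q" for n and h :: "nat \<Rightarrow> site"
  proof -
    have "{X. \<forall>i\<le>n. X i = h i} = (\<Inter>i\<in>{..n}. {X. X i = h i})" by auto
    also have "\<dots> \<in> sets ?Q"
      by (intro sets.finite_INT sets_path_event) auto
    finally show ?thesis .
  qed
  have count: "countable ?H"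
    by (rule countable_subset[of _ "Pi\<^sub>E {..n} (\<lambda>_. UNIV)"]) (auto intro: countable_PiE)
  have disjA: "disjoint_family_on ?A ?H"
  unfolding disjoint_family_on_def
  proof (intro ballI impI)
    fix h h' assume h: "h \<in> ?H" "h' \<in> ?H" "h \<noteq> h'"
    show "?A h \<inter> ?A h' = {}"
    proof (rule ccontr)
      assume "?A h \<inter> ?A h' \<noteq> {}"
      then have "h i = h' i" if "i \<in> {..n}" for i
        using that by fastforce
      then have "h = h'" using h by (intro PiE_ext[of h "{..n}" "\<lambda>_. UNIV" h']) auto
      then show False using h by simp
    qed
  qed
  have BA: "?B h = ?A h \<inter> {X. X (Suc n) = y}" for h
    by (auto simp: le_Suc_eq simp del: split_paired_All)
  have disjB: "disjoint_family_on ?B ?H"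
    unfolding BA by (rule disjoint_family_on_bisimulation[OF disjA]) auto
  have mem: "restrict X {..n} \<in> ?H \<and> X \<in> ?A (restrict X {..n})" if "X n = x" for X
    using that by auto
  have U1: "{X. X n = x} = (\<Union>h\<in>?H. ?A h)"
  proof (intro set_eqI iffI)
    fix X assume "X \<in> {X. X n = x}"
    then show "X \<in> (\<Union>h\<in>?H. ?A h)"
      using mem[of X] by (intro UN_I[of "restrict X {..n}"]) auto
  next
    fix X assume "X \<in> (\<Union>h\<in>?H. ?A h)"
    then obtain h where "h n = x" "\<forall>i\<le>n. X i = h i" by auto
    then show "X \<in> {X. X n = x}" by simp
  qed
  have U2: "{X. X n = x \<and> X (Suc n) = y} = (\<Union>h\<in>?H. ?B h)"
  proof -
    have "{X. X n = x \<and> X (Suc n) = y} = {X. X n = x} \<inter> {X. X (Suc n) = y}" by auto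
    then show ?thesis unfolding BA U1 by auto
  qed
  have w: "emeasure ?Q (?B h) = ennreal (step_prob t x (y - x)) * emeasure ?Q (?A h)" if "h \<in> ?H" for h
  proof -
    have "path_weight (env t) (h(Suc n := y)) (Suc n) = step_prob t x (y - x) * path_weight (env t) h n"
      using that by (auto simp: path_weight_def step_prob_def intro!: prod.cong)
    moreover have "0 \<le> path_weight (env t) h n"
      by (auto simp: path_weight_def intro!: prod_nonneg)
    ultimately show ?thesis
      unfolding emeasure_quenched_path by (simp add: ennreal_mult del: fun_upd_apply)
  qed
  have "emeasure ?Q {X. X n = x \<and> X (Suc n) = y} = (\<integral>\<^sup>+h. emeasure ?Q (?B h) \<partial>count_space ?H)"
    unfolding U2 by (rule emeasure_UN_countable[OF cyl count disjB])
  also have "\<dots> = (\<integral>\<^sup>+h. ennreal (step_prob t x (y - x)) * emeasure ?Q (?A h) \<partial>count_space ?H)"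
    by (rule nn_integral_cong) (use w in simp)
  also have "\<dots> = ennreal (step_prob t x (y - x)) * (\<integral>\<^sup>+h. emeasure ?Q (?A h) \<partial>count_space ?H)"
    by (rule nn_integral_cmult) simp
  also have "(\<integral>\<^sup>+h. emeasure ?Q (?A h) \<partial>count_space ?H) = emeasure ?Q {X. X n = x}"
    unfolding U1 by (rule emeasure_UN_countable[symmetric, OF cyl count disjA])
  finally show ?thesis .
qed

lemma AE_quenched_start: "AE X in quenched \<omega>. X 0 = 0"
proof -
  interpret prob_space "quenched \<omega>" by (rule prob_space_quenched)
  have "emeasure (quenched \<omega>) {X. X 0 = 0} = 1"
    using emeasure_quenched_path[of \<omega> 0 "\<lambda>_. 0"] by (simp add: path_weight_def)
  then show ?thesis
    using AE_in_set_eq_1[OF sets_path_event[of "\<lambda>x. x = 0" 0 \<omega>]] by (simp add: emeasure_eq_measure)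
qed

lemma AE_quenched_steps: "AE X in quenched (env t). \<forall>n. X (Suc n) - X n \<in> steps"
proof -
  have "AE X in quenched (env t). \<not> (X n = x \<and> X (Suc n) = y)" if "y - x \<notin> steps" for n x y
  proof (rule AE_I)
    show "emeasure (quenched (env t)) {X. X n = x \<and> X (Suc n) = y} = 0"
      unfolding emeasure_quenched_step step_prob_eq_0[OF that] by simp
    have "{X. X n = x \<and> X (Suc n) = y} = {X. X n = x} \<inter> {X. X (Suc n) = y}" by auto
    then show "{X. X n = x \<and> X (Suc n) = y} \<in> sets (quenched (env t))"
      using sets_path_event[of "\<lambda>z. z = x" n] sets_path_event[of "\<lambda>z. z = y" "Suc n"] by auto
  qed auto
  then have "AE X in quenched (env t). \<forall>n x y. y - x \<notin> steps \<longrightarrow> \<not> (X n = x \<and> X (Suc n) = y)"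
    by (intro AE_all_countable[THEN iffD2] allI) (simp del: insert_iff split_paired_All)
  then show ?thesis
    by eventually_elim blast
qed

lemma steps_imp_walk_box:
  assumes "X 0 = 0" "\<And>n. X (Suc n) - X n \<in> steps"
  shows "X n \<in> walk_box n"
proof (induction n)
  case (Suc n)
  then show ?case
    using walk_box_step[OF Suc assms(2)[of n]] by simp
qed (simp add: assms(1) walk_box_def zero_prod_def)

lemma AE_quenched_walk_box: "AE X in quenched (env t). X n \<in> walk_box n"
  using AE_quenched_start AE_quenched_steps by eventually_elim (rule steps_imp_walk_box, auto)

lemma emeasure_quenched_occupation:
  "emeasure (quenched (env t)) {X. X n = x} = ennreal (occupation t n x)"
proof (induction n arbitrary: x)
  case 0
  show ?case
  proof (cases "x = 0")
    case True
    then show ?thesis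
      using emeasure_quenched_path[of "env t" 0 "\<lambda>_. 0"] by (simp add: path_weight_def)
  next
    case False
    then show ?thesis
      using emeasure_quenched_path[of "env t" 0 "\<lambda>_. x"] by (simp add: path_weight_def)
  qed
next
  case (Suc n)
  let ?Q = "quenched (env t)"
  let ?C = "\<lambda>e. {X. X n = x - e \<and> X (Suc n) = x}"
  have C: "?C e \<in> sets ?Q" for e
  proof -
    have "?C e = {X. X n = x - e} \<inter> {X. X (Suc n) = x}" by auto
    then show ?thesis
      using sets_path_event[of "\<lambda>z. z = x - e" n] sets_path_event[of "\<lambda>z. z = x" "Suc n"] by auto
  qed
  have "emeasure ?Q {X. X (Suc n) = x} = emeasure ?Q (\<Union>e\<in>steps. ?C e)"
  proof (rule emeasure_eq_AE)
    show "AE X in ?Q. X \<in> {X. X (Suc n) = x} \<longleftrightarrow> X \<in> (\<Union>e\<in>steps. ?C e)"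
      using AE_quenched_steps
    proof eventually_elim
      case (elim X)
      show ?case
      proof
        assume "X \<in> {X. X (Suc n) = x}"
        then have "X \<in> ?C (X (Suc n) - X n)" by simp
        then show "X \<in> (\<Union>e\<in>steps. ?C e)" using elim by blast
      qed auto
    qed
  qed (use C sets_path_event[of "\<lambda>z. z = x" "Suc n"] in auto)
  also have "\<dots> = (\<Sum>e\<in>steps. emeasure ?Q (?C e))"
    by (rule sum_emeasure[symmetric]) (use C in \<open>auto simp: disjoint_family_on_def\<close>)
  also have "\<dots> = (\<Sum>e\<in>steps. ennreal (occupation t n (x - e) * step_prob t (x - e) e))"
    by (intro sum.cong refl) (simp add: emeasure_quenched_step Suc.IH ennreal_mult mult.commute)
  also have "\<dots> = ennreal (occupation t (Suc n) x)"
    unfolding occupation.simps by (rule sum_ennreal) simp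
  finally show ?case .
qed

lemma nn_integral_quenched:
  assumes "\<And>x. x \<in> walk_box n \<Longrightarrow> 0 \<le> F x"
  shows "(\<integral>\<^sup>+X. ennreal (F (X n)) \<partial>quenched (env t)) = ennreal (walk_mean t n F)"
proof -
  let ?Q = "quenched (env t)"
  have "(\<integral>\<^sup>+X. ennreal (F (X n)) \<partial>?Q) =
      (\<integral>\<^sup>+X. (\<Sum>x\<in>walk_box n. ennreal (F x) * indicator {X. X n = x} X) \<partial>?Q)"
  proof (rule nn_integral_cong_AE)
    show "AE X in ?Q. ennreal (F (X n)) = (\<Sum>x\<in>walk_box n. ennreal (F x) * indicator {X. X n = x} X)"
      using AE_quenched_walk_box[where t = t and n = n]
    proof eventually_elim
      case (elim X)
      have "(\<Sum>x\<in>walk_box n. ennreal (F x) * indicator {X. X n = x} X) =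
          (\<Sum>x\<in>walk_box n. if X n = x then ennreal (F x) else 0)"
        by (rule sum.cong) (auto simp: indicator_def)
      then show ?case using elim by simp
    qed
  qed
  also have "\<dots> = (\<Sum>x\<in>walk_box n. \<integral>\<^sup>+X. ennreal (F x) * indicator {X. X n = x} X \<partial>?Q)"
    using sets_path_event by (intro nn_integral_sum) auto
  also have "\<dots> = (\<Sum>x\<in>walk_box n. ennreal (F x) * emeasure ?Q {X. X n = x})"
    using sets_path_event by (intro sum.cong refl nn_integral_cmult_indicator) auto
  also have "\<dots> = (\<Sum>x\<in>walk_box n. ennreal (occupation t n x * F x))"
    using assms by (intro sum.cong refl) (simp add: emeasure_quenched_occupation ennreal_mult mult.commute)
  also have "\<dots> = ennreal (walk_mean t n F)"
    unfolding walk_mean_def using assms by (intro sum_ennreal) auto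
  finally show ?thesis .
qed

section \<open>The time of the first step down\<close>

definition site_time :: "(site \<Rightarrow> bool) \<Rightarrow> site \<Rightarrow> real" where
  "site_time t x = row_time (\<lambda>i. t (i, snd x)) (fst x)"

lemma site_time_bounds: "0 \<le> site_time t x" "site_time t x \<le> 3"
  by (simp_all add: site_time_def row_time_bounds)

lemma site_time_eq:
  "site_time t x = 1 + step_prob t x (1, 0) * site_time t (x + (1, 0))
    + step_prob t x (- 1, 0) * site_time t (x + (- 1, 0))"
  unfolding site_time_def by (cases x) (subst row_time_eq, simp add: row_step_def add_divide_distrib)

lemma measurable_site_time [measurable]: "(\<lambda>t. site_time t x) \<in> borel_measurable (bern p)"
  unfolding site_time_def
  by (rule measurable_compose[OF measurable_bern_reindex measurable_row_time])

lemma depends_on_site_time: "depends_on {z. snd z = snd x} (\<lambda>t. site_time t x)"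
  by (rule depends_onI) (simp add: site_time_def)

lemma integral_site_time: "(\<integral>t. site_time t x \<partial>bern p) = (\<integral>r. row_time r 0 \<partial>bern p)"
proof -
  have "(\<integral>t. site_time t x \<partial>bern p) = (\<integral>t. row_time (\<lambda>i. t (i + fst x, snd x)) 0 \<partial>bern p)"
    using row_time_shift[of "\<lambda>i. t (i, snd x)" "fst x" 0 for t] by (simp add: site_time_def)
  also have "\<dots> = (\<integral>r. row_time r 0 \<partial>bern p)"
    by (rule integral_bern_reindex[where f = "\<lambda>i. (i + fst x, snd x)"]) (auto simp: inj_def)
  finally show ?thesis .
qed

lemma integrable_site_time: "integrable (bern p) (\<lambda>t. site_time t x)"
  by (rule integrable_bern[where C = 3]) (use site_time_bounds in auto)

text \<open>With \<open>b n\<close> the mean residual time in row 0 at time \<open>n\<close>, the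
  first-step equation gives \<open>b (Suc n) = b n - a n\<close>; the series telescopes and
  \<open>b n\<close> decays geometrically.\<close>

lemma survival_sums:
  "(\<lambda>n. walk_mean t n (\<lambda>x. of_bool (snd x = 0))) sums site_time t 0"
proof -
  define a where "a n = walk_mean t n (\<lambda>x. of_bool (snd x = 0))" for n
  define b where "b n = walk_mean t n (\<lambda>x. of_bool (snd x = 0) * site_time t x)" for n
  have a_Suc: "a (Suc n) \<le> 2 / 3 * a n" for n
  proof -
    have "a (Suc n) \<le> walk_mean t n (\<lambda>x. 2 / 3 * of_bool (snd x = 0))"
      unfolding a_def walk_mean_Suc
      by (rule walk_mean_mono) (auto simp: walk_box_def)
    then show ?thesis
      by (simp only: walk_mean_cmult a_def)
  qed
  have a_le: "a n \<le> (2 / 3) ^ n" for n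
  proof (induction n)
    case (Suc n)
    then show ?case using a_Suc[of n] by simp
  qed (simp add: a_def walk_mean_0)
  have "b (Suc n) = walk_mean t n (\<lambda>x. of_bool (snd x = 0) * site_time t x - of_bool (snd x = 0))" for n
    unfolding b_def walk_mean_Suc
  proof (rule walk_mean_cong)
    fix x assume x: "x \<in> walk_box n"
    \<comment> \<open>Below row 1 a step down can leave row 0 but never enter it, so it contributes
      nothing to the left-hand side.\<close>
    then have "snd x \<le> 0" by (auto simp: walk_box_def)
    then show "(\<Sum>e\<in>steps. step_prob t x e * (of_bool (snd (x + e) = 0) * site_time t (x + e))) =
      of_bool (snd x = 0) * site_time t x - of_bool (snd x = 0)"
      using site_time_eq[of t x] by (cases "snd x = 0") (simp_all del: step_prob_simps)
  qed
  then have b_Suc: "b (Suc n) = b n - a n" for n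
    by (simp add: walk_mean_diff a_def b_def)
  have b0: "b 0 = site_time t 0"
    by (simp add: b_def walk_mean_0)
  have part: "(\<Sum>n<N. a n) = site_time t 0 - b N" for N
    by (induction N) (simp_all add: b0 b_Suc)
  have "norm (b n) \<le> 3 * (2 / 3) ^ n" for n
  proof -
    have "0 \<le> b n"
      unfolding b_def using site_time_bounds by (intro walk_mean_nonneg) simp
    moreover have "b n \<le> walk_mean t n (\<lambda>x. 3 * of_bool (snd x = 0))"
      unfolding b_def using site_time_bounds by (intro walk_mean_mono) simp
    ultimately show ?thesis
      using a_le[of n] by (simp add: walk_mean_cmult a_def)
  qed
  moreover have "(\<lambda>n. 3 * (2 / 3 :: real) ^ n) \<longlonglongrightarrow> 0"
    by (intro tendsto_mult_right_zero LIMSEQ_realpow_zero) auto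
  ultimately have "b \<longlonglongrightarrow> 0"
    by (intro Lim_null_comparison[of b "\<lambda>n. 3 * (2 / 3) ^ n"]) auto
  from tendsto_diff[OF tendsto_const[of "site_time t 0"] this] show ?thesis
    unfolding sums_def part[unfolded a_def] by simp
qed

text \<open>Row 0 is left exactly at the first step down and never re-entered, so the tail event at
  \<open>n\<close> is decided by the position at time \<open>n\<close> alone.\<close>

lemma first_down_gt_iff:
  assumes "X 0 = 0" "\<And>n. X (Suc n) - X n \<in> steps"
  shows "enat n < first_down X \<longleftrightarrow> snd (X n) = 0"
proof -
  have "enat n < first_down X \<longleftrightarrow> (\<forall>k. 1 \<le> k \<and> k \<le> n \<longrightarrow> X k - X (k - 1) \<noteq> - e2)"
  proof -
    have "first_down X \<le> enat n \<longleftrightarrow> (\<exists>k. 1 \<le> k \<and> k \<le> n \<and> X k - X (k - 1) = - e2)"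
    proof
      assume le: "first_down X \<le> enat n"
      let ?S = "{n. 1 \<le> n \<and> X n - X (n - 1) = - e2}"
      have ne: "enat ` ?S \<noteq> {}"
      proof
        assume "enat ` ?S = {}"
        then have "first_down X = \<infinity>"
          unfolding first_down_def by (simp add: Inf_enat_def)
        then show False using le by simp
      qed
      \<comment> \<open>A non-empty set in the well-order \<open>enat\<close> attains its infimum;
        the empty set, with infimum \<open>\<infinity>\<close>, has just been excluded.\<close>
      have Inf_mem: "Inf A \<in> A" if "A \<noteq> {}" for A :: "enat set"
        using LeastI_ex[of "\<lambda>x. x \<in> A"] that by (simp add: Inf_enat_def ex_in_conv)
      have "first_down X \<in> enat ` ?S"
        unfolding first_down_def by (rule Inf_mem[OF ne])
      then obtain k where k: "first_down X = enat k" "1 \<le> k" "X k - X (k - 1) = - e2"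
        by blast
      then have "k \<le> n" using le by simp
      then show "\<exists>k. 1 \<le> k \<and> k \<le> n \<and> X k - X (k - 1) = - e2"
        using k by blast
    next
      assume "\<exists>k. 1 \<le> k \<and> k \<le> n \<and> X k - X (k - 1) = - e2"
      then obtain k where k: "1 \<le> k" "k \<le> n" "X k - X (k - 1) = - e2" by blast
      then have "first_down X \<le> enat k"
        unfolding first_down_def by (intro Inf_lower imageI) blast
      also have "\<dots> \<le> enat n" using k by simp
      finally show "first_down X \<le> enat n" .
    qed
    then have "\<not> first_down X \<le> enat n \<longleftrightarrow> (\<forall>k. 1 \<le> k \<and> k \<le> n \<longrightarrow> X k - X (k - 1) \<noteq> - e2)"
      by blast
    then show ?thesis unfolding not_le .
  qed
  also have "\<dots> \<longleftrightarrow> snd (X n) = 0"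
  proof (induction n)
    case (Suc n)
    have "snd (X n) \<le> 0"
      using steps_imp_walk_box[of X n, OF assms] by (auto simp: walk_box_def)
    have "(\<forall>k. 1 \<le> k \<and> k \<le> Suc n \<longrightarrow> X k - X (k - 1) \<noteq> - e2) \<longleftrightarrow>
        (\<forall>k. 1 \<le> k \<and> k \<le> n \<longrightarrow> X k - X (k - 1) \<noteq> - e2) \<and> X (Suc n) - X n \<noteq> - e2"
      by (auto simp: le_Suc_eq)
    also have "\<dots> \<longleftrightarrow> snd (X n) = 0 \<and> X (Suc n) - X n \<noteq> - e2"
      using Suc by simp
    also have "\<dots> \<longleftrightarrow> snd (X (Suc n)) = 0"
      using assms(2)[of n] \<open>snd (X n) \<le> 0\<close> by (auto simp: prod_eq_iff)
    finally show ?case .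
  qed (simp add: assms(1))
  finally show ?thesis .
qed

lemma measurable_first_down [measurable]: "first_down \<in> measurable (quenched \<omega>) (count_space UNIV)"
proof -
  have [measurable]: "Measurable.pred (quenched \<omega>) (\<lambda>X. 1 \<le> n \<and> X n - X (n - 1) = - e2)" for n
    by measurable
  \<comment> \<open>Giving the value \<open>top\<close> to times without a step down replaces an
    infimum over a path-dependent set by one over all \<open>n\<close>.\<close>
  have "first_down X = (INF n. if 1 \<le> n \<and> X n - X (n - 1) = - e2 then enat n else top)" for X
  proof (rule antisym)
    show "first_down X \<le> (INF n. if 1 \<le> n \<and> X n - X (n - 1) = - e2 then enat n else top)"
    proof (rule INF_greatest)
      fix n
      show "first_down X \<le> (if 1 \<le> n \<and> X n - X (n - 1) = - e2 then enat n else top)"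
        unfolding first_down_def by (cases "1 \<le> n \<and> X n - X (n - 1) = - e2") (simp_all add: Inf_lower)
    qed
    show "(INF n. if 1 \<le> n \<and> X n - X (n - 1) = - e2 then enat n else top) \<le> first_down X"
      unfolding first_down_def
    proof (rule Inf_greatest)
      fix k assume "k \<in> enat ` {n. 1 \<le> n \<and> X n - X (n - 1) = - e2}"
      then obtain n where n: "1 \<le> n \<and> X n - X (n - 1) = - e2" "k = enat n" by blast
      show "(INF n. if 1 \<le> n \<and> X n - X (n - 1) = - e2 then enat n else top) \<le> k"
        by (rule INF_lower2[of n]) (simp_all only: n if_True, simp_all)
    qed
  qed
  then have "first_down = (\<lambda>X. INF n. if 1 \<le> n \<and> X n - X (n - 1) = - e2 then enat n else top)"
    by blast
  moreover have "(\<lambda>X. INF n. if 1 \<le> n \<and> X n - X (n - 1) = - e2 then enat n else top)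
      \<in> measurable (quenched \<omega>) (count_space UNIV)"
    by (intro measurable_INF) (auto intro!: measurable_If)
  ultimately show ?thesis by simp
qed

lemma nn_integral_quenched_first_down:
  "(\<integral>\<^sup>+X. ennreal_of_enat (first_down X) \<partial>quenched (env t)) = ennreal (site_time t 0)"
proof -
  let ?Q = "quenched (env t)"
  have *: "emeasure ?Q {X \<in> space ?Q. enat n < first_down X} = ennreal (walk_mean t n (\<lambda>x. of_bool (snd x = 0)))" for n
  proof -
    have "emeasure ?Q {X \<in> space ?Q. enat n < first_down X} = emeasure ?Q {X. snd (X n) = 0}"
    proof (rule emeasure_eq_AE)
      show "AE X in ?Q. X \<in> {X \<in> space ?Q. enat n < first_down X} \<longleftrightarrow> X \<in> {X. snd (X n) = 0}"
        using AE_quenched_start AE_quenched_steps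
        by eventually_elim (simp add: first_down_gt_iff del: insert_iff)
      show "{X. snd (X n) = 0} \<in> sets ?Q"
        by (rule sets_path_event)
    qed measurable
    also have "\<dots> = (\<integral>\<^sup>+X. indicator {X. snd (X n) = 0} X \<partial>?Q)"
      by (rule nn_integral_indicator[symmetric, OF sets_path_event])
    also have "\<dots> = (\<integral>\<^sup>+X. ennreal (of_bool (snd (X n) = 0)) \<partial>?Q)"
      by (intro nn_integral_cong) (auto simp: indicator_def)
    also have "\<dots> = ennreal (walk_mean t n (\<lambda>x. of_bool (snd x = 0)))"
      by (rule nn_integral_quenched) simp
    finally show ?thesis .
  qed
  have "(\<integral>\<^sup>+X. ennreal_of_enat (first_down X) \<partial>?Q) = (\<Sum>n. ennreal (walk_mean t n (\<lambda>x. of_bool (snd x = 0))))"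
    unfolding nn_integral_enat_function[OF measurable_first_down] * ..
  also have "\<dots> = ennreal (site_time t 0)"
    using survival_sums[of t] by (subst suminf_ennreal2) (auto simp: sums_iff intro!: walk_mean_nonneg)
  finally show ?thesis .
qed

section \<open>A law of large numbers for processes with uncorrelated increments\<close>

lemma slln_interpolation:
  fixes s :: "nat \<Rightarrow> real"
  assumes inc: "\<And>n. \<bar>s (Suc n) - s n\<bar> \<le> C"
    and sq: "(\<lambda>N. s (N ^ 2) / real N ^ 2) \<longlonglongrightarrow> 0"
  shows "(\<lambda>n. s n / real n) \<longlonglongrightarrow> 0"
proof -
  \<comment> \<open>\<open>r n ^ 2\<close> is the last square not exceeding \<open>n\<close>; the
    gap is at most \<open>2 * r n\<close>, negligible against \<open>r n ^ 2\<close>.\<close>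
  define r where "r n = nat \<lfloor>sqrt (real n)\<rfloor>" for n
  have C: "0 \<le> C" using inc[of 0] by linarith
  have dist: "\<bar>s (m + k) - s m\<bar> \<le> C * real k" for m k
  proof (induction k)
    case (Suc k)
    have "\<bar>s (m + Suc k) - s m\<bar> \<le> \<bar>s (Suc (m + k)) - s (m + k)\<bar> + \<bar>s (m + k) - s m\<bar>" by simp
    also have "\<dots> \<le> C + C * real k" by (intro add_mono inc Suc)
    finally show ?case by (simp add: algebra_simps)
  qed simp
  have r: "r n ^ 2 \<le> n" "n \<le> r n ^ 2 + 2 * r n" for n
  proof -
    have r1: "real (r n) \<le> sqrt (real n)" "sqrt (real n) < real (r n) + 1"
      unfolding r_def by (simp_all add: of_nat_nat)
    have "real (r n) ^ 2 \<le> real n"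
      using power_mono[OF r1(1), of 2] by simp
    then show "r n ^ 2 \<le> n" by (metis of_nat_le_iff of_nat_power)
    have "real n < (real (r n) + 1) ^ 2"
      using power_strict_mono[OF r1(2), of 2] by simp
    then have "real n < real ((r n + 1) ^ 2)" by (simp add: add.commute)
    then have "n < (r n + 1) ^ 2" by (simp only: of_nat_less_iff)
    then show "n \<le> r n ^ 2 + 2 * r n" by (simp add: power2_eq_square)
  qed
  have r_lim: "filterlim r at_top sequentially"
    unfolding r_def
    by (intro filterlim_compose[OF filterlim_nat_sequentially] filterlim_compose[OF filterlim_floor_sequentially]
        filterlim_compose[OF sqrt_at_top] filterlim_real_sequentially)
  have "(\<lambda>n. \<bar>s (r n ^ 2) / real (r n) ^ 2\<bar> + 2 * C * inverse (real (r n))) \<longlonglongrightarrow> 0 + 2 * C * 0"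
    by (intro tendsto_add tendsto_mult tendsto_const tendsto_rabs_zero
        filterlim_compose[OF sq r_lim] filterlim_compose[OF lim_inverse_n r_lim])
  then have lim: "(\<lambda>n. \<bar>s (r n ^ 2) / real (r n) ^ 2\<bar> + 2 * C * inverse (real (r n))) \<longlonglongrightarrow> 0"
    by simp
  have "\<forall>\<^sub>F n in sequentially. 1 \<le> r n"
    using r_lim by (simp add: filterlim_at_top)
  then have "\<forall>\<^sub>F n in sequentially. norm (s n / real n) \<le> \<bar>s (r n ^ 2) / real (r n) ^ 2\<bar> + 2 * C * inverse (real (r n))"
  proof eventually_elim
    case (elim n)
    have pos: "0 < real (r n)" using elim by simp
    have rn: "real (r n) ^ 2 \<le> real n"
      using r(1)[of n] by (metis of_nat_le_iff of_nat_power)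
    have "\<bar>s n - s (r n ^ 2)\<bar> \<le> C * real (n - r n ^ 2)"
      using dist[of "r n ^ 2" "n - r n ^ 2"] r(1)[of n] by simp
    also have "\<dots> \<le> C * (2 * real (r n))"
    proof (rule mult_left_mono[OF _ C])
      have "n - r n ^ 2 \<le> 2 * r n" using r(2)[of n] by linarith
      then show "real (n - r n ^ 2) \<le> 2 * real (r n)" by (metis of_nat_le_iff of_nat_mult of_nat_numeral)
    qed
    finally have "\<bar>s n\<bar> \<le> \<bar>s (r n ^ 2)\<bar> + 2 * C * real (r n)" by simp
    then have "\<bar>s n\<bar> / real n \<le> (\<bar>s (r n ^ 2)\<bar> + 2 * C * real (r n)) / real (r n) ^ 2"
      using pos rn C by (intro frac_le) auto
    also have "\<dots> = \<bar>s (r n ^ 2) / real (r n) ^ 2\<bar> + 2 * C * inverse (real (r n))"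
      using pos by (simp add: field_simps power2_eq_square)
    finally show ?case by simp
  qed
  then show ?thesis
    by (rule Lim_null_comparison[OF _ lim])
qed

section \<open>Second moments and convergence along squares\<close>

lemma occupation_le_1: "occupation t n x \<le> 1"
proof (cases "x \<in> walk_box n")
  case True
  then have "occupation t n x = walk_mean t n (\<lambda>y. of_bool (y = x))"
    unfolding walk_mean_def by simp
  also have "\<dots> \<le> walk_mean t n (\<lambda>_. 1)"
    by (rule walk_mean_mono) simp
  finally show ?thesis
    by (simp add: walk_mean_const)
qed (simp add: occupation_outside)

lemma abs_walk_mean_le:
  assumes "\<And>x. x \<in> walk_box n \<Longrightarrow> \<bar>F x\<bar> \<le> D"
  shows "\<bar>walk_mean t n F\<bar> \<le> D"
proof -
  have "walk_mean t n F \<le> walk_mean t n (\<lambda>_. D)" "walk_mean t n (\<lambda>_. - D) \<le> walk_mean t n F"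
    by (rule walk_mean_mono, use assms in force)+
  then show ?thesis
    unfolding walk_mean_const by linarith
qed

lemma measurable_walk_mean [measurable]:
  assumes "\<And>x. (\<lambda>t. F t x) \<in> borel_measurable (bern p)"
  shows "(\<lambda>t. walk_mean t n (F t)) \<in> borel_measurable (bern p)"
proof -
  note [measurable] = assms
  show ?thesis unfolding walk_mean_def by measurable
qed

lemma integrable_walk_mean:
  assumes "\<And>x. (\<lambda>t. F t x) \<in> borel_measurable (bern p)" "\<And>t x. x \<in> walk_box n \<Longrightarrow> \<bar>F t x\<bar> \<le> D"
  shows "integrable (bern p) (\<lambda>t. walk_mean t n (F t))"
  by (rule integrable_bern[OF measurable_walk_mean[OF assms(1)] abs_walk_mean_le[OF assms(2)]])

lemma abs_step_average_le:
  assumes "\<And>e. e \<in> steps \<Longrightarrow> \<bar>f e\<bar> \<le> C"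
  shows "\<bar>\<Sum>e\<in>steps. step_prob t x e * f e\<bar> \<le> C"
proof -
  have "\<bar>\<Sum>e\<in>steps. step_prob t x e * f e\<bar> \<le> (\<Sum>e\<in>steps. step_prob t x e * C)"
    by (rule order_trans[OF sum_abs sum_mono]) (simp add: abs_mult mult_left_mono assms del: insert_iff)
  then show ?thesis
    unfolding sum_distrib_right[symmetric] sum_step_prob by simp
qed

text \<open>In the expanded square only the cross term is not controlled by \<open>C\<close>. By
  \<open>orth\<close> it vanishes, site by site, after averaging over the environment. This annealed
  orthogonality is weaker than a quenched martingale property, as the corrected time
  requires.\<close>

lemma variance_bound:
  fixes U :: "(site \<Rightarrow> bool) \<Rightarrow> nat \<Rightarrow> site \<Rightarrow> real"
  assumes U0: "\<And>t. U t 0 0 = 0"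
    and inc: "\<And>t n x e. e \<in> steps \<Longrightarrow> \<bar>U t (Suc n) (x + e) - U t n x\<bar> \<le> C"
    and bd: "\<And>t n x. x \<in> walk_box n \<Longrightarrow> \<bar>U t n x\<bar> \<le> B n"
    and meas: "\<And>n x. (\<lambda>t. U t n x) \<in> borel_measurable (bern p)"
    and orth: "\<And>n x. x \<in> walk_box n \<Longrightarrow> (\<integral>t. occupation t n x * U t n x *
      (\<Sum>e\<in>steps. step_prob t x e * (U t (Suc n) (x + e) - U t n x)) \<partial>bern p) = 0"
  shows "(\<integral>t. walk_mean t n (\<lambda>x. U t n x ^ 2) \<partial>bern p) \<le> C ^ 2 * real n"
proof (induction n)
  case 0
  show ?case by (simp add: walk_mean_0 U0)
next
  case (Suc n)
  interpret prob_space "bern p :: (site \<Rightarrow> bool) measure" by (rule prob_space_bern)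
  note [measurable] = meas
  define drift where "drift t x = (\<Sum>e\<in>steps. step_prob t x e * (U t (Suc n) (x + e) - U t n x))" for t x
  have drift_m [measurable]: "(\<lambda>t. drift t x) \<in> borel_measurable (bern p)" for x
    unfolding drift_def by measurable
  have drift_le: "\<bar>drift t x\<bar> \<le> C" for t x
    unfolding drift_def by (rule abs_step_average_le[OF inc])
  have Udrift: "\<bar>U t n x * drift t x\<bar> \<le> B n * C" if "x \<in> walk_box n" for t x
    unfolding abs_mult using bd[OF that, of t] drift_le[of t x] by (intro mult_mono) auto
  have sq: "\<bar>U t m x ^ 2\<bar> \<le> B m ^ 2" if "x \<in> walk_box m" for t m x
    using power_mono[OF bd[OF that, of t], of 2] by simp
  have step: "walk_mean t (Suc n) (\<lambda>x. U t (Suc n) x ^ 2)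
      \<le> walk_mean t n (\<lambda>x. U t n x ^ 2) + 2 * walk_mean t n (\<lambda>x. U t n x * drift t x) + C ^ 2" for t
  proof -
    have "(\<Sum>e\<in>steps. step_prob t x e * U t (Suc n) (x + e) ^ 2)
        \<le> U t n x ^ 2 + 2 * (U t n x * drift t x) + C ^ 2" for x
    proof -
      let ?d = "\<lambda>e. U t (Suc n) (x + e) - U t n x"
      have "step_prob t x e * U t (Suc n) (x + e) ^ 2
          \<le> U t n x ^ 2 * step_prob t x e + 2 * U t n x * (step_prob t x e * ?d e) + C ^ 2 * step_prob t x e"
        if "e \<in> steps" for e
      proof -
        have "?d e ^ 2 \<le> C ^ 2"
          using power_mono[OF inc[OF that, of t n x], of 2] by simp
        then have "U t (Suc n) (x + e) ^ 2 \<le> U t n x ^ 2 + 2 * U t n x * ?d e + C ^ 2"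
          by (simp add: power2_eq_square algebra_simps)
        from mult_left_mono[OF this step_prob_nonneg[of t x e]] show ?thesis
          by (simp add: algebra_simps)
      qed
      then have "(\<Sum>e\<in>steps. step_prob t x e * U t (Suc n) (x + e) ^ 2)
          \<le> (\<Sum>e\<in>steps. U t n x ^ 2 * step_prob t x e + 2 * U t n x * (step_prob t x e * ?d e) + C ^ 2 * step_prob t x e)"
        by (rule sum_mono)
      also have "\<dots> = U t n x ^ 2 + 2 * (U t n x * drift t x) + C ^ 2"
        unfolding sum.distrib sum_distrib_left[symmetric] sum_step_prob drift_def by simp
      finally show ?thesis .
    qed
    then have "walk_mean t (Suc n) (\<lambda>x. U t (Suc n) x ^ 2)
        \<le> walk_mean t n (\<lambda>x. U t n x ^ 2 + 2 * (U t n x * drift t x) + C ^ 2)"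
      unfolding walk_mean_Suc by (intro walk_mean_mono)
    then show ?thesis
      by (simp only: walk_mean_add walk_mean_cmult walk_mean_const)
  qed
  have i1: "integrable (bern p) (\<lambda>t. walk_mean t m (\<lambda>x. U t m x ^ 2))" for m
    by (rule integrable_walk_mean[where D = "B m ^ 2"]) (use sq in auto)
  have i2: "integrable (bern p) (\<lambda>t. walk_mean t n (\<lambda>x. U t n x * drift t x))"
    by (rule integrable_walk_mean[where D = "B n * C"]) (use Udrift in auto)
  have zero: "(\<integral>t. walk_mean t n (\<lambda>x. U t n x * drift t x) \<partial>bern p) = 0"
  proof -
    have "integrable (bern p) (\<lambda>t. occupation t n x * (U t n x * drift t x))" if x: "x \<in> walk_box n" for x
    proof (rule integrable_bern[where C = "1 * (B n * C)"])
      show "\<bar>occupation t n x * (U t n x * drift t x)\<bar> \<le> 1 * (B n * C)" for t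
        unfolding abs_mult[of "occupation t n x"]
        using occupation_le_1[of t n x] Udrift[OF x, of t] by (intro mult_mono) auto
    qed measurable
    then have "(\<integral>t. walk_mean t n (\<lambda>x. U t n x * drift t x) \<partial>bern p)
      = (\<Sum>x\<in>walk_box n. \<integral>t. occupation t n x * (U t n x * drift t x) \<partial>bern p)"
      unfolding walk_mean_def by (intro Bochner_Integration.integral_sum) auto
    also have "\<dots> = 0"
      using orth[of _ n] unfolding drift_def[symmetric] mult.assoc by (intro sum.neutral) auto
    finally show ?thesis .
  qed
  have "(\<integral>t. walk_mean t (Suc n) (\<lambda>x. U t (Suc n) x ^ 2) \<partial>bern p)
      \<le> (\<integral>t. walk_mean t n (\<lambda>x. U t n x ^ 2) + 2 * walk_mean t n (\<lambda>x. U t n x * drift t x) + C ^ 2 \<partial>bern p)"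
    by (rule integral_mono[OF i1 _ step]) (use i1 i2 in auto)
  also have "\<dots> = (\<integral>t. walk_mean t n (\<lambda>x. U t n x ^ 2) \<partial>bern p) + C ^ 2"
    using i1[of n] i2 zero by simp
  finally show ?case
    using Suc by (simp add: algebra_simps)
qed

text \<open>At time \<open>N ^ 2\<close> the normalised second moment is at most
  \<open>D / N^2\<close>. By Tonelli, first in the environment and then on paths, the series of
  squares is almost surely finite, so its terms tend to 0.\<close>

lemma walk_slln_squares:
  fixes U :: "(site \<Rightarrow> bool) \<Rightarrow> nat \<Rightarrow> site \<Rightarrow> real"
  assumes meas: "\<And>n x. (\<lambda>t. U t n x) \<in> borel_measurable (bern p)"
    and bd: "\<And>t n x. x \<in> walk_box n \<Longrightarrow> \<bar>U t n x\<bar> \<le> B n"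
    and var: "\<And>n. (\<integral>t. walk_mean t n (\<lambda>x. U t n x ^ 2) \<partial>bern p) \<le> D * real n"
  shows "AE t in bern p. AE X in quenched (env t). (\<lambda>N. U t (N ^ 2) (X (N ^ 2)) / real N ^ 2) \<longlonglongrightarrow> 0"
proof -
  note [measurable] = meas
  define W where "W N t x = (U t (N ^ 2) x / real N ^ 2) ^ 2" for N t x
  have W_m [measurable]: "(\<lambda>t. W N t x) \<in> borel_measurable (bern p)" for N x
    unfolding W_def by measurable
  have W_nn: "0 \<le> W N t x" for N t x by (simp add: W_def)
  have nn: "(\<integral>\<^sup>+X. ennreal (W N t (X (N ^ 2))) \<partial>quenched (env t)) = ennreal (walk_mean t (N ^ 2) (W N t))" for N t
    by (rule nn_integral_quenched) (rule W_nn)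
  have int: "integrable (bern p) (\<lambda>t. walk_mean t n (\<lambda>x. U t n x ^ 2))" for n
  proof (rule integrable_walk_mean[where D = "B n ^ 2"])
    show "\<bar>(U t n x)\<^sup>2\<bar> \<le> (B n)\<^sup>2" if "x \<in> walk_box n" for t x
      using power_mono[OF bd[OF that, of t], of 2] by simp
  qed measurable
  have D: "0 \<le> D"
  proof -
    have "0 \<le> (\<integral>t. walk_mean t 1 (\<lambda>x. U t 1 x ^ 2) \<partial>bern p)"
      by (intro integral_nonneg_AE AE_I2 walk_mean_nonneg) simp
    then show ?thesis using var[of 1] by simp
  qed
  have bound: "(\<integral>\<^sup>+t. ennreal (walk_mean t (N ^ 2) (W N t)) \<partial>bern p) \<le> ennreal (D * inverse (real N ^ 2))" for N
  proof -
    have eq: "walk_mean t (N ^ 2) (W N t) = inverse (real N ^ 4) * walk_mean t (N ^ 2) (\<lambda>x. U t (N ^ 2) x ^ 2)" for t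
      unfolding walk_mean_cmult[symmetric] W_def
      by (intro walk_mean_cong) (simp add: power_mult_distrib power_inverse divide_inverse mult.commute flip: power_mult)
    have "(\<integral>\<^sup>+t. ennreal (walk_mean t (N ^ 2) (W N t)) \<partial>bern p) =
        ennreal (\<integral>t. walk_mean t (N ^ 2) (W N t) \<partial>bern p)"
      by (intro nn_integral_eq_integral AE_I2 walk_mean_nonneg W_nn)
        (unfold eq, intro integrable_mult_right int)
    also have "(\<integral>t. walk_mean t (N ^ 2) (W N t) \<partial>bern p) \<le> inverse (real N ^ 4) * (D * real (N ^ 2))"
      unfolding eq integral_mult_right_zero by (intro mult_left_mono var) simp
    \<comment> \<open>For \<open>N = 0\<close> both sides vanish because
      \<open>inverse 0 = 0\<close>.\<close>
    also have "\<dots> = D * inverse (real N ^ 2)"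
      by (cases "N = 0") (simp_all add: field_simps power_numeral_reduce)
    finally show ?thesis by (simp add: ennreal_leI)
  qed
  have "(\<integral>\<^sup>+t. (\<Sum>N. ennreal (walk_mean t (N ^ 2) (W N t))) \<partial>bern p) =
      (\<Sum>N. \<integral>\<^sup>+t. ennreal (walk_mean t (N ^ 2) (W N t)) \<partial>bern p)"
    by (intro nn_integral_suminf) measurable
  also have "\<dots> \<le> (\<Sum>N. ennreal (D * inverse (real N ^ 2)))"
    by (intro suminf_le bound) auto
  also have "\<dots> = ennreal (\<Sum>N. D * inverse (real N ^ 2))"
    using D inverse_power_summable[of 2, where ?'a = real]
    by (intro suminf_ennreal2 summable_mult) auto
  also have "\<dots> < \<infinity>" by simp
  finally have "AE t in bern p. (\<Sum>N. ennreal (walk_mean t (N ^ 2) (W N t))) \<noteq> \<infinity>"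
    by (intro nn_integral_PInf_AE) auto
  then show ?thesis
  proof eventually_elim
    case (elim t)
    have Wq [measurable]: "(\<lambda>X. ennreal (W N t (X n))) \<in> borel_measurable (quenched (env t))" for N n
      by (rule measurable_compose[OF measurable_path_position]) simp
    have "(\<integral>\<^sup>+X. (\<Sum>N. ennreal (W N t (X (N ^ 2)))) \<partial>quenched (env t)) \<noteq> \<infinity>"
      using elim by (subst nn_integral_suminf) (simp_all add: nn)
    then have "AE X in quenched (env t). (\<Sum>N. ennreal (W N t (X (N ^ 2)))) \<noteq> \<infinity>"
      by (intro nn_integral_PInf_AE) auto
    then show ?case
    proof eventually_elim
      case (elim X)
      have "summable (\<lambda>N. W N t (X (N ^ 2)))"
        using elim W_nn by (intro summable_suminf_not_top) auto
      then have "(\<lambda>N. W N t (X (N ^ 2))) \<longlonglongrightarrow> 0"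
        by (rule summable_LIMSEQ_zero)
      then have "(\<lambda>N. sqrt (W N t (X (N ^ 2)))) \<longlonglongrightarrow> sqrt 0"
        by (rule tendsto_real_sqrt)
      then show ?case
        unfolding W_def real_sqrt_abs real_sqrt_zero by (rule tendsto_rabs_zero_cancel)
    qed
  qed
qed

section \<open>The velocity\<close>

lemma walk_slln:
  fixes U :: "(site \<Rightarrow> bool) \<Rightarrow> nat \<Rightarrow> site \<Rightarrow> real"
  assumes U0: "\<And>t. U t 0 0 = 0"
    and inc: "\<And>t n x e. e \<in> steps \<Longrightarrow> \<bar>U t (Suc n) (x + e) - U t n x\<bar> \<le> C"
    and bd: "\<And>t n x. x \<in> walk_box n \<Longrightarrow> \<bar>U t n x\<bar> \<le> B n"
    and meas: "\<And>n x. (\<lambda>t. U t n x) \<in> borel_measurable (bern p)"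
    and orth: "\<And>n x. x \<in> walk_box n \<Longrightarrow> (\<integral>t. occupation t n x * U t n x *
      (\<Sum>e\<in>steps. step_prob t x e * (U t (Suc n) (x + e) - U t n x)) \<partial>bern p) = 0"
  shows "AE t in bern p. AE X in quenched (env t). (\<lambda>n. U t n (X n) / real n) \<longlonglongrightarrow> 0"
proof -
  have "AE t in bern p. AE X in quenched (env t). (\<lambda>N. U t (N ^ 2) (X (N ^ 2)) / real N ^ 2) \<longlonglongrightarrow> 0"
    by (rule walk_slln_squares[OF meas bd variance_bound[OF U0 inc bd meas orth]])
  then show ?thesis
  proof eventually_elim
    case (elim t)
    with AE_quenched_steps[of t] show ?case
    proof eventually_elim
      case (elim X)
      have "\<bar>U t (Suc n) (X (Suc n)) - U t n (X n)\<bar> \<le> C" for n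
        using inc[of "X (Suc n) - X n" t n "X n"] elim(1) by (simp del: insert_iff)
      then show ?case
        using elim(2) by (rule slln_interpolation)
    qed
  qed
qed

text \<open>The coefficient 3 balances both kinds of sites: the mean of the change of
  \<open>x - 3 * y\<close> is \<open>0 + 3 * (1/3)\<close> at a three-step site and
  \<open>- 1/2 + 3 * (1/2)\<close> at a two-step site, both equal to 1. This is the origin of
  \<open>v1 = 1 + 3 * v2\<close>.\<close>

lemma drift_slln:
  "AE t in bern p. AE X in quenched (env t).
    (\<lambda>n. (real_of_int (fst (X n)) - 3 * real_of_int (snd (X n)) - real n) / real n) \<longlonglongrightarrow> 0"
proof (rule walk_slln[where U = "\<lambda>t n x. real_of_int (fst x) - 3 * real_of_int (snd x) - real n"
      and C = 3 and B = "\<lambda>n. 5 * real n"])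
  show "\<bar>real_of_int (fst x) - 3 * real_of_int (snd x) - real n\<bar> \<le> 5 * real n" if "x \<in> walk_box n" for n x
    using that by (auto simp: walk_box_def)
  show "(\<integral>t. occupation t n x * (real_of_int (fst x) - 3 * real_of_int (snd x) - real n) *
      (\<Sum>e\<in>steps. step_prob t x e * (real_of_int (fst (x + e)) - 3 * real_of_int (snd (x + e)) - real (Suc n)
        - (real_of_int (fst x) - 3 * real_of_int (snd x) - real n))) \<partial>bern p) = 0" for n x
  proof -
    have "(\<Sum>e\<in>steps. step_prob t x e * (real_of_int (fst (x + e)) - 3 * real_of_int (snd (x + e)) - real (Suc n)
        - (real_of_int (fst x) - 3 * real_of_int (snd x) - real n))) = 0" for t
      by simp
    then show ?thesis by (simp only: mult_zero_right integral_zero)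
  qed
qed auto

text \<open>The increment of the corrected time has conditional mean zero except on steps down, and
  these lead to a row that is independent of all rows above it.\<close>

lemma time_slln:
  fixes p :: real
  defines "m \<equiv> \<integral>r. row_time r 0 \<partial>bern p"
  shows "AE t in bern p. AE X in quenched (env t).
    (\<lambda>n. (real n + site_time t (X n) - site_time t 0 + m * real_of_int (snd (X n))) / real n) \<longlonglongrightarrow> 0"
proof (rule walk_slln[where U = "\<lambda>t n x. real n + site_time t x - site_time t 0 + m * real_of_int (snd x)"
      and C = "4 + \<bar>m\<bar>" and B = "\<lambda>n. real n + 3 + \<bar>m\<bar> * real n"])
  fix t n x e assume e: "e \<in> steps"
  \<comment> \<open>The bound \<open>4 + \<bar>m\<bar>\<close> collects 1 for the time, 3 for the
    change of \<open>site_time\<close>, and \<open>\<bar>m\<bar>\<close> for a step down.\<close>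
  have "\<bar>m * real_of_int (snd e)\<bar> \<le> \<bar>m\<bar>"
    using e by auto
  then show "\<bar>real (Suc n) + site_time t (x + e) - site_time t 0 + m * real_of_int (snd (x + e)) -
      (real n + site_time t x - site_time t 0 + m * real_of_int (snd x))\<bar> \<le> 4 + \<bar>m\<bar>"
    using site_time_bounds[of t x] site_time_bounds[of t "x + e"]
    by (simp add: algebra_simps)
next
  have bd: "\<bar>real n + site_time t x - site_time t 0 + m * real_of_int (snd x)\<bar> \<le> real n + 3 + \<bar>m\<bar> * real n"
    if "x \<in> walk_box n" for t n x
  proof -
    have "\<bar>m * real_of_int (snd x)\<bar> \<le> \<bar>m\<bar> * real n"
      unfolding abs_mult using that by (intro mult_left_mono) (auto simp: walk_box_def)
    then show ?thesis
      using site_time_bounds[of t x] site_time_bounds[of t 0] by linarith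
  qed
  then show "\<bar>real n + site_time t x - site_time t 0 + m * real_of_int (snd x)\<bar> \<le> real n + 3 + \<bar>m\<bar> * real n"
    if "x \<in> walk_box n" for t n x using that .
  fix n x assume x: "x \<in> walk_box n"
  let ?U = "\<lambda>t. real n + site_time t x - site_time t 0 + m * real_of_int (snd x)"
  let ?y = "x + (0, - 1)"
  \<comment> \<open>The first-step equation of \<open>site_time\<close> cancels the horizontal
    steps; only the time in the row entered by a step down was not accounted for.\<close>
  have drift: "(\<Sum>e\<in>steps. step_prob t x e * (real (Suc n) + site_time t (x + e) - site_time t 0
      + m * real_of_int (snd (x + e)) - ?U t)) = step_prob t x (0, - 1) * (site_time t ?y - m)" for t
  proof -
    have "(\<Sum>e\<in>steps. step_prob t x e * (real (Suc n) + site_time t (x + e) - site_time t 0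
      + m * real_of_int (snd (x + e)) - ?U t)) = (\<Sum>e\<in>steps. step_prob t x e * (site_time t (x + e) + m * real_of_int (snd e))
        + (1 - site_time t x) * step_prob t x e)"
      by (intro sum.cong refl) (simp add: algebra_simps)
    also have "\<dots> = (\<Sum>e\<in>steps. step_prob t x e * (site_time t (x + e) + m * real_of_int (snd e))) + (1 - site_time t x)"
      unfolding sum.distrib sum_distrib_left[symmetric] sum_step_prob by simp
    also have "\<dots> = step_prob t x (0, - 1) * (site_time t ?y - m)"
      using site_time_eq[of t x] by (simp add: algebra_simps del: step_prob_simps)
    finally show ?thesis .
  qed
  have "(\<integral>t. (occupation t n x * ?U t * step_prob t x (0, - 1)) * (site_time t ?y - m) \<partial>bern p) =
      (\<integral>t. occupation t n x * ?U t * step_prob t x (0, - 1) \<partial>bern p) * (\<integral>t. site_time t ?y - m \<partial>bern p)"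
  proof (rule integral_bern_mult[where S = "{z. snd x \<le> snd z}" and S' = "{z. snd z = snd x - 1}"
        and C = "1 * (real n + 3 + \<bar>m\<bar> * real n) * 1" and D = "3 + \<bar>m\<bar>"])
    show "\<bar>occupation t n x * ?U t * step_prob t x (0, - 1)\<bar> \<le> 1 * (real n + 3 + \<bar>m\<bar> * real n) * 1" for t
      unfolding abs_mult using occupation_le_1[of t n x] bd[OF x, of t] by (intro mult_mono) auto
    show "depends_on {z. snd x \<le> snd z} (\<lambda>t. occupation t n x * ?U t * step_prob t x (0, - 1))"
    proof (rule depends_onI)
      fix t t' :: "site \<Rightarrow> bool"
      assume *: "\<And>z. z \<in> {z. snd x \<le> snd z} \<Longrightarrow> t z = t' z"
      \<comment> \<open>The starting site lies at or above the row of \<open>x\<close>, so the term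
        \<open>site_time t 0\<close> belongs to the upper rows too.\<close>
      have "snd x \<le> 0" using x by (auto simp: walk_box_def)
      then have "site_time t 0 = site_time t' 0"
        by (intro depends_onD[OF depends_on_site_time] *) auto
      moreover have "site_time t x = site_time t' x"
        by (intro depends_onD[OF depends_on_site_time] *) auto
      moreover have "occupation t n x = occupation t' n x"
        by (intro depends_onD[OF depends_on_occupation] *)
      moreover have "t x = t' x" by (rule *) simp
      ultimately show "occupation t n x * ?U t * step_prob t x (0, - 1) = occupation t' n x * ?U t' * step_prob t' x (0, - 1)"
        by simp
    qed
    show "\<bar>site_time t ?y - m\<bar> \<le> 3 + \<bar>m\<bar>" for t
      using site_time_bounds[of t ?y] by linarith
    show "depends_on {z. snd z = snd x - 1} (\<lambda>t. site_time t ?y - m)"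
    proof (rule depends_onI)
      fix t t' :: "site \<Rightarrow> bool"
      assume *: "\<And>z. z \<in> {z. snd z = snd x - 1} \<Longrightarrow> t z = t' z"
      have "site_time t ?y = site_time t' ?y"
        by (intro depends_onD[OF depends_on_site_time] *) auto
      then show "site_time t ?y - m = site_time t' ?y - m" by simp
    qed
  qed auto
  \<comment> \<open>Here the value of \<open>m\<close> matters: it centres the time in the new row,
    by stationarity.\<close>
  also have "(\<integral>t. site_time t ?y - m \<partial>bern p) = 0"
  proof -
    interpret prob_space "bern p :: (site \<Rightarrow> bool) measure" by (rule prob_space_bern)
    show ?thesis
      using integrable_site_time[of p ?y] integral_site_time[of p ?y] by (simp add: m_def)
  qed
  finally show "(\<integral>t. occupation t n x * ?U t * (\<Sum>e\<in>steps. step_prob t x e * (real (Suc n) + site_time t (x + e) - site_time t 0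
      + m * real_of_int (snd (x + e)) - ?U t)) \<partial>bern p) = 0"
    unfolding drift by (simp add: mult.assoc del: step_prob_simps)
qed auto

text \<open>Two linear relations determine the limit \<open>(x, y)\<close>: the corrected time gives
  \<open>1 + m * y = 0\<close>, as the bounded corrector disappears after division by
  \<open>n\<close>, and \<open>drift_slln\<close> gives \<open>x - 3 * y = 1\<close>.\<close>

lemma walk_velocity:
  fixes p :: real
  defines "m \<equiv> \<integral>r. row_time r 0 \<partial>bern p"
  assumes m: "m \<noteq> 0"
  shows "AE t in bern p. AE X in quenched (env t).
    (\<lambda>n. (1 / real n) *\<^sub>R to_plane (X n)) \<longlonglongrightarrow> (1 - 3 / m, - 1 / m)"
  using time_slln[of p, folded m_def] drift_slln[of p]
proof eventually_elim
  case (elim t)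
  from elim show ?case
  proof eventually_elim
    case (elim X)
    let ?x = "\<lambda>n. real_of_int (fst (X n))" and ?y = "\<lambda>n. real_of_int (snd (X n))"
    have pos: "\<forall>\<^sub>F n in sequentially. 0 < real n"
      by (rule eventually_sequentiallyI[of 1]) simp
    have bounded: "(\<lambda>n. (site_time t (X n) - site_time t 0) / real n) \<longlonglongrightarrow> 0"
    proof (rule Lim_null_comparison)
      show "\<forall>\<^sub>F n in sequentially. norm ((site_time t (X n) - site_time t 0) / real n) \<le> 3 * inverse (real n)"
        using pos
      proof eventually_elim
        case (elim n)
        have "\<bar>site_time t (X n) - site_time t 0\<bar> \<le> 3"
          using site_time_bounds[of t "X n"] site_time_bounds[of t 0] by linarith
        then show ?case
          using elim by (simp add: field_simps)
      qed
      show "(\<lambda>n. 3 * inverse (real n)) \<longlonglongrightarrow> 0"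
        by (intro tendsto_mult_right_zero lim_inverse_n)
    qed
    have y: "(\<lambda>n. ?y n / real n) \<longlonglongrightarrow> - 1 / m"
    proof (rule Lim_transform_eventually)
      show "(\<lambda>n. ((real n + site_time t (X n) - site_time t 0 + m * ?y n) / real n - 1
          - (site_time t (X n) - site_time t 0) / real n) / m) \<longlonglongrightarrow> - 1 / m"
        using tendsto_divide[OF tendsto_diff[OF tendsto_diff[OF elim(1) tendsto_const[of 1]] bounded] tendsto_const m]
        by simp
      show "\<forall>\<^sub>F n in sequentially. ((real n + site_time t (X n) - site_time t 0 + m * ?y n) / real n - 1
          - (site_time t (X n) - site_time t 0) / real n) / m = ?y n / real n"
        using pos by eventually_elim (use m in \<open>simp add: field_simps\<close>)
    qed
    have x: "(\<lambda>n. ?x n / real n) \<longlonglongrightarrow> 1 - 3 / m"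
    proof (rule Lim_transform_eventually)
      show "(\<lambda>n. (?x n - 3 * ?y n - real n) / real n + 3 * (?y n / real n) + 1) \<longlonglongrightarrow> 1 - 3 / m"
        using tendsto_add[OF tendsto_add[OF elim(2) tendsto_mult[OF tendsto_const[of 3] y]] tendsto_const[of 1]]
        by (simp add: add.commute)
      show "\<forall>\<^sub>F n in sequentially. (?x n - 3 * ?y n - real n) / real n + 3 * (?y n / real n) + 1 = ?x n / real n"
        using pos by eventually_elim (simp add: field_simps)
    qed
    show ?case
      using tendsto_Pair[OF x y] by (simp add: to_plane_def)
  qed
qed

section \<open>From an abstract environment to the product measure\<close>

lemma measurable_env: "(\<lambda>t. env t x) \<in> measurable (bern p) (count_space UNIV)"
  unfolding env_def by measurable

lemma measurable_quenched_env: "(\<lambda>t. quenched (env t)) \<in> measurable (bern p) (subprob_algebra path_space)"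
proof -
  have "(\<lambda>t x. env t x) \<in> measurable (bern p) env_space"
    by (rule measurable_PiM_single', rule measurable_env) auto
  from measurable_compose[OF this measurable_quenched] show ?thesis
    by (rule measurable_prob_algebraD)
qed

text \<open>The Boolean field of three-step sites has law \<open>bern p\<close>, and almost surely
  it determines the environment at all of the countably many sites; the annealed law only sees the
  law of the environment.\<close>

lemma annealed_eq_bern:
  fixes M :: "'a measure" and G :: "site \<Rightarrow> 'a \<Rightarrow> site set"
  assumes p: "0 < p" "p < 1"
    and M: "prob_space M"
    and indep: "prob_space.indep_vars M (\<lambda>_. count_space UNIV) G UNIV"
    and three: "\<And>x. \<P>(w in M. G x w = {e1, - e1, - e2}) = p"
    and two: "\<And>x. \<P>(w in M. G x w = {- e1, - e2}) = 1 - p"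
  shows "annealed M G = annealed (bern p) (\<lambda>x t. env t x)"
proof -
  interpret prob_space M by (rule M)
  have G [measurable]: "G x \<in> measurable M (count_space UNIV)" for x
    using indep unfolding indep_vars_def by blast
  define T where "T x w \<longleftrightarrow> G x w = {e1, - e1, - e2}" for x w
  have T_meas: "T x \<in> measurable M (count_space UNIV)" for x
    unfolding T_def by (rule measurable_compose[OF G]) simp
  have T_indep: "indep_vars (\<lambda>_. count_space UNIV) T UNIV"
    unfolding T_def[abs_def] by (rule indep_vars_compose2[OF indep]) simp
  have T_law: "distr M (count_space UNIV) (T x) = measure_pmf (bernoulli_pmf p)" for x
  proof (rule measure_eqI_finite)
    fix b :: bool
    have T_sets: "{w \<in> space M. T x w} \<in> events"
      using measurable_sets[OF T_meas[of x], of "{True}"] by (simp add: vimage_def Int_def conj_commute)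
    have "prob {w \<in> space M. T x w} = p"
      using three[of x] by (simp add: T_def)
    moreover have "prob {w \<in> space M. \<not> T x w} = 1 - p"
      using prob_neg[OF T_sets] calculation by simp
    moreover have "emeasure (distr M (count_space UNIV) (T x)) {b} = ennreal (prob {w \<in> space M. T x w = b})"
      by (subst emeasure_distr[OF T_meas]) (auto simp: emeasure_eq_measure intro!: arg_cong[where f = prob])
    ultimately show "emeasure (distr M (count_space UNIV) (T x)) {b} = emeasure (measure_pmf (bernoulli_pmf p)) {b}"
      using p by (cases b) (simp_all add: emeasure_pmf_single)
  qed auto
  have T_distr: "distr M (Pi\<^sub>M UNIV (\<lambda>_. count_space UNIV)) (\<lambda>w x. T x w) = bern p"
  proof -
    have "distr M (\<Pi>\<^sub>M i\<in>UNIV. count_space UNIV) (\<lambda>x. \<lambda>i\<in>UNIV. T i x) =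
        (\<Pi>\<^sub>M i\<in>UNIV. distr M (count_space UNIV) (T i))"
      by (rule iffD1[OF indep_vars_iff_distr_eq_PiM T_indep]) (simp, rule T_meas)
    then show ?thesis
      unfolding T_law restrict_UNIV bern_def[symmetric] .
  qed
  have T_all: "(\<lambda>w x. T x w) \<in> measurable M (Pi\<^sub>M UNIV (\<lambda>_. count_space UNIV))"
    by (rule measurable_PiM_single', rule T_meas) auto
  have G_sets: "{w \<in> space M. G x w = g} \<in> events" for x g
    using measurable_sets[OF G[of x], of "{g}"] by (simp add: vimage_def Int_def conj_commute)
  have "AE w in M. G x w = env (\<lambda>y. T y w) x" for x
  proof -
    \<comment> \<open>The two step sets must be seen to differ, so that their probabilities add up
      to 1 and exclude any third value.\<close>
    have "(1, 0) \<in> {e1, - e1, - e2} \<and> (1, 0) \<notin> {- e1, - e2 :: site}"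
      by simp
    then have "{e1, - e1, - e2} \<noteq> {- e1, - e2 :: site}"
      by metis
    then have "{w \<in> space M. G x w = {e1, - e1, - e2}} \<inter> {w \<in> space M. G x w = {- e1, - e2}} = {}"
      by blast
    from finite_measure_Union[OF G_sets G_sets this]
    have "prob ({w \<in> space M. G x w = {e1, - e1, - e2}} \<union> {w \<in> space M. G x w = {- e1, - e2}}) = 1"
      unfolding three two by simp
    from AE_prob_1[OF this]
    show ?thesis
      by eventually_elim (auto simp: env_def T_def)
  qed
  then have AE: "AE w in M. \<forall>x. G x w = env (\<lambda>y. T y w) x"
    by (simp add: AE_all_countable)
  show ?thesis
  proof (rule measure_eqI)
    show "sets (annealed M G) = sets (annealed (bern p) (\<lambda>x t. env t x))"
      using prob_space_annealed(2)[OF M G] prob_space_annealed(2)[OF prob_space_bern measurable_env] by simp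
    fix A assume "A \<in> sets (annealed M G)"
    then have A: "A \<in> sets path_space"
      using prob_space_annealed(2)[OF M G] by simp
    have meas: "(\<lambda>t. emeasure (quenched (env t)) A) \<in> borel_measurable (bern p)"
      by (rule measurable_compose[OF measurable_quenched_env measurable_emeasure_subprob_algebra[OF A]])
    have "emeasure (annealed M G) A = (\<integral>\<^sup>+w. emeasure (quenched (\<lambda>x. G x w)) A \<partial>M)"
      by (rule emeasure_annealed[OF M G A])
    also have "\<dots> = (\<integral>\<^sup>+w. emeasure (quenched (env (\<lambda>y. T y w))) A \<partial>M)"
    proof (rule nn_integral_cong_AE)
      show "AE w in M. emeasure (quenched (\<lambda>x. G x w)) A = emeasure (quenched (env (\<lambda>y. T y w))) A"
        using AE
      proof eventually_elim
        case (elim w)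
        then have "(\<lambda>x. G x w) = env (\<lambda>y. T y w)" by blast
        then show ?case by simp
      qed
    qed
    also have "\<dots> = (\<integral>\<^sup>+t. emeasure (quenched (env t)) A \<partial>distr M (Pi\<^sub>M UNIV (\<lambda>_. count_space UNIV)) (\<lambda>w x. T x w))"
      using meas by (intro nn_integral_distr[symmetric] T_all) (simp add: measurable_cong_sets[OF sets_bern refl])
    also have "\<dots> = emeasure (annealed (bern p) (\<lambda>x t. env t x)) A"
      unfolding T_distr using emeasure_annealed[OF prob_space_bern measurable_env A] by simp
    finally show "emeasure (annealed M G) A = emeasure (annealed (bern p) (\<lambda>x t. env t x)) A" .
  qed
qed

text \<open>Leaving a row takes at least one step; positivity of the mean permits the division in
  the velocity.\<close>

lemma one_le_integral_row_time: "1 \<le> (\<integral>r. row_time r 0 \<partial>bern p)"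
proof -
  interpret prob_space "bern p :: (int \<Rightarrow> bool) measure" by (rule prob_space_bern)
  have "1 \<le> row_time r 0" for r
    using row_time_bounds(1)[of r] row_time_eq[of r 0] by (simp add: row_step_def)
  then have "(\<integral>r. 1 \<partial>(bern p :: (int \<Rightarrow> bool) measure)) \<le> (\<integral>r. row_time r 0 \<partial>(bern p :: (int \<Rightarrow> bool) measure))"
    by (intro integral_mono integrable_bern[where C = 3]) (use row_time_bounds in auto)
  then show ?thesis by simp
qed

lemma nn_integral_annealed_first_down:
  "(\<integral>\<^sup>+X. ennreal_of_enat (first_down X) \<partial>annealed (bern p) (\<lambda>x t. env t x))
    = ennreal (\<integral>r. row_time r 0 \<partial>bern p)"
proof -
  have "first_down \<in> measurable path_space (count_space UNIV)"
    using measurable_first_down[of undefined] measurable_cong_sets[OF sets_quenched refl] by blast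
  then have "(\<lambda>X. ennreal_of_enat (first_down X)) \<in> borel_measurable path_space"
    by (rule measurable_compose) simp
  then have "(\<integral>\<^sup>+X. ennreal_of_enat (first_down X) \<partial>annealed (bern p) (\<lambda>x t. env t x)) =
      (\<integral>\<^sup>+t. \<integral>\<^sup>+X. ennreal_of_enat (first_down X) \<partial>quenched (env t) \<partial>bern p)"
    unfolding annealed_def by (rule nn_integral_bind[OF _ measurable_quenched_env])
  also have "\<dots> = ennreal (\<integral>t. site_time t 0 \<partial>bern p)"
    unfolding nn_integral_quenched_first_down
    by (intro nn_integral_eq_integral integrable_site_time AE_I2 site_time_bounds)
  finally show ?thesis
    unfolding integral_site_time .
qed

lemma measurable_velocity_event:
  "Measurable.pred path_space (\<lambda>X. (\<lambda>n. (1 / real n) *\<^sub>R to_plane (X n)) \<longlonglongrightarrow> v)"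
proof (rule measurable_limit)
  show "(\<lambda>X. (1 / real n) *\<^sub>R to_plane (X n)) \<in> borel_measurable path_space" for n
    by (rule measurable_compose[of "\<lambda>X. X n" _ "count_space UNIV"]) auto
qed


theorem mainTheorem9:
  fixes M :: "'a measure"
    and G :: "site \<Rightarrow> 'a \<Rightarrow> site set"
    and p S0 S1 A0 v1 v2 :: real
    and ET :: ennreal
  assumes p: "0 < p" "p < 1"
    and M: "prob_space M"
    and G_indep: "prob_space.indep_vars M (\<lambda>_. count_space UNIV) G UNIV"
    and G_three: "\<And>x. \<P>(w in M. G x w = {e1, - e1, - e2}) = p"
    and G_two: "\<And>x. \<P>(w in M. G x w = {- e1, - e2}) = 1 - p"
    and S0: "S0 = 3 + (1 - p)^2 / (gam - 1) *
        ((gam^3 + 6 * gam^2 - 3 * gam) * Theta (p * gam^2)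
         + (3 * gam^3 - 7 * gam^2 - 7 * gam + 3) * Theta (p * gam)
         - (3 * gam^2 - 6 * gam - 1) * Theta p)"
    and S1: "S1 = 3 + (1 - p) *
        (gam^2 * Theta (p * gam^2) + 3 * (gam^2 - 1) * Theta (p * gam) - Theta p)"
    and A0: "A0 = (1 - p)^2 / (gam - 1) *
        (gam * (1 - 2 * gam) * Theta (p * gam^2)
         - (gam^3 - 2 * gam^2 - 2 * gam + 1) * Theta (p * gam)
         + gam * (gam - 2) * Theta p)"
    and ET: "ET = (\<integral>\<^sup>+X. ennreal_of_enat (first_down X) \<partial>annealed M G)"
    and v2: "v2 = - 1 / enn2real ET"
    and v1: "v1 = 1 + 3 * v2"
  shows "ET = ennreal (S0 + S1 * A0 / (1 - (1 - p) * (1 - gam^2) * Theta (p * gam)))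
    \<and> \<P>(X in annealed M G. (\<lambda>n. (1 / real n) *\<^sub>R to_plane (X n)) \<longlonglongrightarrow> (v1, v2)) = 1"
proof
  let ?A = "annealed (bern p) (\<lambda>x t. env t x)"
  define m where "m = (\<integral>r. row_time r 0 \<partial>bern p)"
  have m: "1 \<le> m"
    unfolding m_def by (rule one_le_integral_row_time)
  have annealed: "annealed M G = ?A"
    by (rule annealed_eq_bern[OF p M G_indep G_three G_two])
  have ET_m: "ET = ennreal m"
    unfolding ET annealed nn_integral_annealed_first_down m_def ..
  show "ET = ennreal (S0 + S1 * A0 / (1 - (1 - p) * (1 - gam^2) * Theta (p * gam)))"
    unfolding ET_m m_def integral_row_time_closed_form[OF less_imp_le[OF p(1)] p(2) S0 S1 A0] ..
  \<comment> \<open>\<open>enn2real ET\<close> is \<open>m\<close> itself, because \<open>ET\<close>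
    is \<open>ennreal m\<close> with \<open>m\<close> non-negative.\<close>
  have v: "v1 = 1 - 3 / m" "v2 = - 1 / m"
    using m unfolding v1 v2 ET_m by simp_all
  let ?P = "\<lambda>X. (\<lambda>n. (1 / real n) *\<^sub>R to_plane (X n)) \<longlonglongrightarrow> (v1, v2)"
  interpret A: prob_space ?A
    by (rule prob_space_annealed(1)[OF prob_space_bern measurable_env])
  have sets: "sets ?A = sets path_space"
    by (rule prob_space_annealed(2)[OF prob_space_bern measurable_env])
  have "AE t in bern p. AE X in quenched (env t). ?P X"
    unfolding v m_def using m by (intro walk_velocity) (simp add: m_def)
  then have "AE X in ?A. ?P X"
    unfolding annealed_def by (rule iffD2[OF AE_bind[OF measurable_quenched_env measurable_velocity_event]])
  moreover have event: "{X \<in> space ?A. ?P X} \<in> sets ?A"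
    using measurable_velocity_event[of "(v1, v2)"] sets_eq_imp_space_eq[OF sets] sets
    by (simp add: pred_def)
  ultimately show "\<P>(X in annealed M G. ?P X) = 1"
    unfolding annealed by (simp only: A.prob_Collect_eq_1[OF event])
qed

end
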